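(* Let $\mathfrak{h}$ be a $d$-dimensional complex vector space with a nondegenerate symmetric bilinear form $\langle\cdot,\cdot\rangle$, let $0\neq h\in\mathfrak{h}$ with $\langle h,h\rangle\neq0$, and let $G=\mathrm{Aut}(V_{\widehat{\mathfrak{h}}}(1,0),\omega_h)$. Then all $G$-orbits of $\mathrm{Reg}(\mathfrak{h})_h$ are the following (each set consisting of elements of $\mathrm{Reg}(\mathfrak{h})_h$): 1) $I_1(k)=\{(\mathfrak{h}',h)\mid\dim\mathfrak{h}'=k\}$ for $k=1,\dots,d$; 2) $I_2(k)=\{(\mathfrak{h}',0)\mid\dim\mathfrak{h}'=k\}$ for $k=0,1,\dots,d-1$; 3) for each $y\in\mathbb{C}$ with $y\neq0,\langle h,h\rangle$: $I_3(k,y)=\{(\mathfrak{h}',h')\mid\dim\mathfrak{h}'=k,\ \langle h',h'\rangle=y,\ h'\neq0,h\}$ for $k=1,\dots,d-1$; 4) $I_4(k,\langle h,h\rangle)=\{(\mathfrak{h}',h')\mid\dim\mathfrak{h}'=k,\ \langle h',h'\rangle=\langle h,h\rangle,\ h'\neq0,h\}$ for $k=1,\dots,d-2$; 5) $I_5(k,0)=\{(\mathfrak{h}',h')\mid\dim\mathfrak{h}'=k,\ \langle h',h'\rangle=0,\ h'\neq0\}$ for $k=2,\dots,d-1$. That is, $$\mathrm{Reg}(\mathfrak{h})_h=\bigcup_{k=1}^{d}I_1(k)\cup\bigcup_{k=0}^{d-1}I_2(k)\cup\bigcup_{k=1}^{d-1}\Big(\bigcup_{y\neq0,\langle h,h\rangle}I_3(k,y)\Big)\cup\bigcup_{k=1}^{d-2}I_4(k,\langle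 h,h\rangle)\cup\bigcup_{k=2}^{d-1}I_5(k,0).$$
   Context: Everything is over $\mathbb{C}$. A subspace $\mathfrak{h}'\subseteq\mathfrak{h}$ (possibly $0$) is regular if $\langle\cdot,\cdot\rangle|_{\mathfrak{h}'}$ is nondegenerate; then $\mathfrak{h}=\mathfrak{h}'\oplus\mathfrak{h}'^{\perp}$ and $P_{\mathfrak{h}'}:\mathfrak{h}\to\mathfrak{h}'$ is the projection. $\mathrm{Reg}(\mathfrak{h})_h=\{(\mathfrak{h}',h')\mid\mathfrak{h}'\text{ a regular subspace of }\mathfrak{h},\ h'=P_{\mathfrak{h}'}(h)\}$. $\widehat{\mathfrak{h}}=\mathbb{C}[t,t^{-1}]\otimes\mathfrak{h}\oplus\mathbb{C}C$ is the Lie algebra with $C$ central and $[u\otimes t^m,v\otimes t^n]=m\langle u,v\rangle\delta_{m,-n}C$. $V_{\widehat{\mathfrak{h}}}(1,0)=U(\widehat{\mathfrak{h}})\otimes_{U(\widehat{\mathfrak{h}}^{\geq 0})}\mathbb{C}\mathbf{1}$, where $\widehat{\mathfrak{h}}^{\ge 0}=\mathbb{C}[t]\otimes\mathfrak{h}\oplus\mathbb{C}C$ acts on $\mathbb{C}\mathbf{1}$ with $\mathbb{C}[t]\otimes\mathfrak{h}$ acting by $0$ and $C$ by $1$; $u(n)$ is the action of $u\otimes t^n$; it is a vertex algebra with vacuum $\mathbf{1}$ and $Y(u(-1)\mathbf{1},z)=\sum_{n}u(n)z^{-n-1}$. For an orthonormal basis $h_1,\dots,h_d$, $\omega_h=\frac12\sum_i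 h_i(-1)^2\mathbf{1}+h(-2)\mathbf{1}$, a conformal vector. $G$ is the group of vertex algebra automorphisms of $V_{\widehat{\mathfrak{h}}}(1,0)$ fixing $\omega_h$; identifying $\mathfrak{h}$ with the weight-one subspace via $u\mapsto u(-1)\mathbf{1}$, restriction to $\mathfrak{h}$ identifies $G$ with $\{\sigma\in\mathrm{O}(\mathfrak{h})\mid\sigma(h)=h\}$, and $G$ acts on $\mathrm{Reg}(\mathfrak{h})_h$ by $\sigma\cdot(\mathfrak{h}',h')=(\sigma(\mathfrak{h}'),\sigma(h'))$. *)

theory Defs
  imports Complex_Main "HOL-Library.Poly_Mapping" "HOL-Library.Product_Plus"
    "HOL-Library.Groups_Big_Fun"
begin

section \<open>Complex vector spaces\<close>

class complex_vector = ab_group_add +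
  fixes scaleC :: "complex \<Rightarrow> 'a \<Rightarrow> 'a" (infixr "*\<^sub>C" 75)
  assumes scaleC_add_right: "a *\<^sub>C (x + y) = a *\<^sub>C x + a *\<^sub>C y"
    and scaleC_add_left: "(a + b) *\<^sub>C x = a *\<^sub>C x + b *\<^sub>C x"
    and scaleC_scaleC: "a *\<^sub>C b *\<^sub>C x = (a * b) *\<^sub>C x"
    and scaleC_one: "1 *\<^sub>C x = x"

global_interpretation complex_vector:
  vector_space "scaleC :: complex \<Rightarrow> 'a \<Rightarrow> 'a::complex_vector"
  defines csubspace = complex_vector.subspace
    and cspan = complex_vector.span
    and cdependent = complex_vector.dependent
    and cdim = complex_vector.dim
  by unfold_locales
    (rule scaleC_add_right scaleC_add_left scaleC_scaleC scaleC_one)+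

abbreviation clinear :: "('a::complex_vector \<Rightarrow> 'b::complex_vector) \<Rightarrow> bool"
  where "clinear \<equiv> Vector_Spaces.linear scaleC scaleC"

abbreviation cindependent :: "'a::complex_vector set \<Rightarrow> bool"
  where "cindependent B \<equiv> \<not> cdependent B"

instantiation complex :: complex_vector
begin
definition "scaleC_complex a (x::complex) = a * x"
instance by standard (simp_all add: scaleC_complex_def algebra_simps)
end

instantiation prod :: (complex_vector, complex_vector) complex_vector
begin
definition "scaleC_prod a p = (a *\<^sub>C fst p, a *\<^sub>C snd p)"
instance
  by standard
    (simp_all add: scaleC_prod_def prod_eq_iff scaleC_add_right scaleC_add_left
      scaleC_scaleC scaleC_one)
end

instantiation poly_mapping :: (type, complex_vector) complex_vector
begin
definition "scaleC_poly_mapping a p = Poly_Mapping.map (scaleC a) p"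

lemma lookup_scaleC:
  "Poly_Mapping.lookup (a *\<^sub>C p) k = a *\<^sub>C Poly_Mapping.lookup p k"
  for p :: "'a \<Rightarrow>\<^sub>0 'b"
  by (simp add: scaleC_poly_mapping_def map.rep_eq when_def)

instance
  by standard
    (rule poly_mapping_eqI, simp add: lookup_scaleC lookup_add scaleC_add_right
      scaleC_add_left scaleC_scaleC scaleC_one)+
end

text \<open>A finite-dimensional complex vector space with a nondegenerate symmetric bilinear form.\<close>

class quadratic_space = complex_vector +
  fixes form :: "'a \<Rightarrow> 'a \<Rightarrow> complex" ("\<langle>_, _\<rangle>")
  assumes form_add_left: "\<langle>x + y, z\<rangle> = \<langle>x, z\<rangle> + \<langle>y, z\<rangle>"
    and form_scale_left: "\<langle>a *\<^sub>C x, z\<rangle> = a * \<langle>x, z\<rangle>"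
    and form_sym: "\<langle>x, y\<rangle> = \<langle>y, x\<rangle>"
    and form_nondegenerate: "(\<forall>y. \<langle>x, y\<rangle> = 0) \<Longrightarrow> x = 0"
    and finite_dimensional: "\<exists>B. finite B \<and> (\<forall>x. \<exists>c. x = (\<Sum>b\<in>B. c b *\<^sub>C b))"


section \<open>Induced modules of Lie algebras\<close>

text \<open>
  For a Lie algebra \<open>L\<close> with bracket \<open>br\<close>, the free vector space on the words
  in \<open>L\<close>, modulo the span of \<open>uea_relations br\<close>, is the universal enveloping
  algebra \<open>U(L)\<close>: the first two sets of relations cut the free vector space on words down to
  the tensor algebra, the third one is \<open>xy - yx = [x,y]\<close>.
  For a subalgebra \<open>P\<close> acting on the one-dimensional space \<open>\<complex>1\<close> through \<open>\<chi>\<close>,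
  adding \<open>w x \<otimes> 1 = w \<otimes> \<chi>(x) 1\<close> for \<open>x \<in> P\<close> gives the induced module
  \<open>U(L) \<otimes>\<^bsub>U(P)\<^esub> \<complex>1\<close>; the word \<open>x\<^sub>1 \<dots> x\<^sub>n\<close> represents \<open>x\<^sub>1 \<cdots> x\<^sub>n \<otimes> 1\<close>.
\<close>

definition word :: "'l list \<Rightarrow> 'l list \<Rightarrow>\<^sub>0 complex"
  where "word w = Poly_Mapping.single w 1"

definition uea_relations ::
    "('l::complex_vector \<Rightarrow> 'l \<Rightarrow> 'l) \<Rightarrow> ('l list \<Rightarrow>\<^sub>0 complex) set"
  where "uea_relations br =
    {word (v @ (x + y) # w) - word (v @ x # w) - word (v @ y # w) | v x y w. True} \<union>
    {word (v @ (a *\<^sub>C x) # w) - a *\<^sub>C word (v @ x # w) | v a x w. True} \<union>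
    {word (v @ x # y # w) - word (v @ y # x # w) - word (v @ br x y # w) | v x y w. True}"

definition inducing_relations ::
    "'l set \<Rightarrow> ('l \<Rightarrow> complex) \<Rightarrow> ('l list \<Rightarrow>\<^sub>0 complex) set"
  where "inducing_relations P \<chi> = {word (w @ [x]) - \<chi> x *\<^sub>C word w | w x. x \<in> P}"

definition left_mult :: "'l \<Rightarrow> ('l list \<Rightarrow>\<^sub>0 complex) \<Rightarrow> ('l list \<Rightarrow>\<^sub>0 complex)"
  where "left_mult x p =
    (\<Sum>w\<in>Poly_Mapping.keys p. Poly_Mapping.lookup p w *\<^sub>C word (x # w))"

lemma lookup_left_mult:
  "Poly_Mapping.lookup (left_mult x p) w =
    (case w of [] \<Rightarrow> 0 | y # v \<Rightarrow> if y = x then Poly_Mapping.lookup p v else 0)"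
proof (cases w)
  case Nil
  then show ?thesis
    by (simp add: left_mult_def lookup_sum lookup_scaleC word_def lookup_single
        scaleC_complex_def when_def)
next
  case (Cons y v)
  have "Poly_Mapping.lookup (left_mult x p) w =
      (\<Sum>u\<in>Poly_Mapping.keys p. if u = v then (if y = x then Poly_Mapping.lookup p v else 0) else 0)"
    unfolding left_mult_def lookup_sum
    by (rule sum.cong)
      (auto simp: Cons lookup_scaleC word_def lookup_single scaleC_complex_def when_def)
  also have "\<dots> = (if y = x then Poly_Mapping.lookup p v else 0)"
    by (simp add: in_keys_iff)
  finally show ?thesis by (simp add: Cons)
qed

lemma left_mult_add: "left_mult x (p + q) = left_mult x p + left_mult x q"
  by (rule poly_mapping_eqI) (simp add: lookup_left_mult lookup_add split: list.split)

lemma left_mult_scaleC: "left_mult x (a *\<^sub>C p) = a *\<^sub>C left_mult x p"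
  by (rule poly_mapping_eqI)
    (simp add: lookup_left_mult lookup_scaleC scaleC_complex_def split: list.split)

lemma left_mult_diff: "left_mult x (p - q) = left_mult x p - left_mult x q"
  by (rule poly_mapping_eqI) (simp add: lookup_left_mult lookup_minus split: list.split)

lemma left_mult_zero: "left_mult x 0 = 0"
  by (simp add: left_mult_def)

lemma left_mult_word: "left_mult x (word w) = word (x # w)"
  by (simp add: left_mult_def word_def scaleC_one)

lemma left_mult_relations:
  assumes "r \<in> uea_relations br \<union> inducing_relations P \<chi>"
  shows "left_mult x r \<in> uea_relations br \<union> inducing_relations P \<chi>"
  using assms
  unfolding uea_relations_def inducing_relations_def
  apply (elim UnE CollectE exE conjE)
     apply (simp_all only: left_mult_diff left_mult_scaleC left_mult_word)
     apply (rule UnI1, rule UnI1, rule UnI1, rule CollectI, metis append_Cons)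
    apply (rule UnI1, rule UnI1, rule UnI2, rule CollectI, metis append_Cons)
   apply (rule UnI1, rule UnI2, rule CollectI, metis append_Cons)
  apply (rule UnI2, rule CollectI, metis append_Cons)
  done

lemma left_mult_span:
  assumes "p \<in> cspan (uea_relations br \<union> inducing_relations P \<chi>)"
  shows "left_mult x p \<in> cspan (uea_relations br \<union> inducing_relations P \<chi>)"
  using assms
proof (induction rule: complex_vector.span_induct_alt)
  case base
  then show ?case by (simp add: left_mult_zero complex_vector.span_zero)
next
  case (step a r q)
  then show ?case
    unfolding left_mult_add left_mult_scaleC
    by (rule complex_vector.span_add[OF complex_vector.span_scale[OF
            complex_vector.span_base[OF left_mult_relations]]])
qed


section \<open>The affine Lie algebra and the module \<open>V(1,0)\<close>\<close>

text \<open>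
  \<open>\<complex>[t,t\<^sup>-\<^sup>1] \<otimes> \<h> \<oplus> \<complex>C\<close>: a finitely supported function \<open>f\<close> stands for
  \<open>\<Sum>\<^sub>n f(n) \<otimes> t\<^sup>n\<close>, and the second component is the coefficient of \<open>C\<close>.
\<close>

type_synonym 'h affine = "(int \<Rightarrow>\<^sub>0 'h) \<times> complex"

definition affine_elem :: "'h::quadratic_space \<Rightarrow> int \<Rightarrow> 'h affine"
  where "affine_elem u n = (Poly_Mapping.single n u, 0)"

definition affine_bracket :: "'h::quadratic_space affine \<Rightarrow> 'h affine \<Rightarrow> 'h affine"
  where "affine_bracket x y =
    (0, \<Sum>m\<in>Poly_Mapping.keys (fst x).
          of_int m * \<langle>Poly_Mapping.lookup (fst x) m, Poly_Mapping.lookup (fst y) (- m)\<rangle>)"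

definition affine_nonneg :: "'h::quadratic_space affine set"
  where "affine_nonneg = {x. \<forall>n<0. Poly_Mapping.lookup (fst x) n = 0}"

definition heis_relations :: "('h::quadratic_space affine list \<Rightarrow>\<^sub>0 complex) set"
  where "heis_relations = uea_relations affine_bracket \<union> inducing_relations affine_nonneg snd"

definition heis_rel ::
    "('h::quadratic_space affine list \<Rightarrow>\<^sub>0 complex) \<Rightarrow> ('h affine list \<Rightarrow>\<^sub>0 complex) \<Rightarrow> bool"
  where "heis_rel p q \<longleftrightarrow> p - q \<in> cspan heis_relations"

lemma heis_rel_diff:
  assumes "heis_rel p p'" "heis_rel q q'"
  shows "heis_rel (p - q) (p' - q')"
proof -
  have "(p - q) - (p' - q') = (p - p') - (q - q')" by simp
  then show ?thesis
    using assms unfolding heis_rel_def by (metis complex_vector.span_diff)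
qed

lemma heis_rel_add:
  assumes "heis_rel p p'" "heis_rel q q'"
  shows "heis_rel (p + q) (p' + q')"
proof -
  have "(p + q) - (p' + q') = (p - p') + (q - q')" by simp
  then show ?thesis
    using assms unfolding heis_rel_def by (metis complex_vector.span_add)
qed

lemma heis_rel_refl: "heis_rel p p"
  by (simp add: heis_rel_def complex_vector.span_zero)

lemma equivp_heis_rel: "equivp heis_rel"
proof (rule equivpI)
  show "reflp heis_rel" by (simp add: reflp_def heis_rel_refl)
  show "symp heis_rel"
    unfolding symp_def heis_rel_def by (metis complex_vector.span_neg minus_diff_eq)
  show "transp heis_rel"
  proof (rule transpI)
    fix p q r
    assume "heis_rel p q" "heis_rel q r"
    then have "(p - q) + (q - r) \<in> cspan heis_relations"
      unfolding heis_rel_def by (rule complex_vector.span_add)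
    then show "heis_rel p r" by (simp add: heis_rel_def)
  qed
qed

quotient_type (overloaded) 'h heis = "'h::quadratic_space affine list \<Rightarrow>\<^sub>0 complex" / heis_rel
  by (rule equivp_heis_rel)

instantiation heis :: (quadratic_space) complex_vector
begin

lift_definition zero_heis :: "'a heis" is 0 .

lift_definition plus_heis :: "'a heis \<Rightarrow> 'a heis \<Rightarrow> 'a heis" is "(+)"
  by (rule heis_rel_add)

lift_definition minus_heis :: "'a heis \<Rightarrow> 'a heis \<Rightarrow> 'a heis" is "(-)"
  by (rule heis_rel_diff)

lift_definition uminus_heis :: "'a heis \<Rightarrow> 'a heis" is uminus
  using heis_rel_diff[OF heis_rel_refl[of 0]] by simp

lift_definition scaleC_heis :: "complex \<Rightarrow> 'a heis \<Rightarrow> 'a heis" is scaleC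
  unfolding heis_rel_def
  by (metis complex_vector.scale_right_diff_distrib complex_vector.span_scale)

instance
  by standard
    (transfer; simp add: heis_rel_refl algebra_simps scaleC_add_right scaleC_add_left
      scaleC_scaleC scaleC_one)+

end

lift_definition vac :: "'h::quadratic_space heis" is "word []" .

definition affine_act :: "'h::quadratic_space affine \<Rightarrow> 'h heis \<Rightarrow> 'h heis"
  where "affine_act x p = abs_heis (left_mult x (rep_heis p))"

lemma affine_act_abs: "affine_act x (abs_heis p) = abs_heis (left_mult x p)"
proof -
  have "heis_rel (rep_heis (abs_heis p)) p"
    by (rule Quotient3_rep_abs[OF Quotient3_heis heis_rel_refl])
  then have "heis_rel (left_mult x (rep_heis (abs_heis p))) (left_mult x p)"
    unfolding heis_rel_def heis_relations_def left_mult_diff[symmetric]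
    by (rule left_mult_span)
  then show ?thesis
    unfolding affine_act_def by (simp add: heis.abs_eq_iff)
qed

text \<open>\<open>mode u n\<close> is the operator \<open>u(n)\<close>.\<close>

definition mode :: "'h::quadratic_space \<Rightarrow> int \<Rightarrow> 'h heis \<Rightarrow> 'h heis"
  where "mode u n = affine_act (affine_elem u n)"


section \<open>Vertex algebras\<close>

text \<open>
  \<open>Y a n b\<close> is the \<open>n\<close>-th product \<open>a\<^sub>n b\<close>, i.e. \<open>Y(a,z) b = \<Sum>\<^sub>n (a\<^sub>n b) z\<^sup>-\<^sup>n\<^sup>-\<^sup>1\<close>. The
  last clause is the Jacobi identity in components (Borcherds identity); by the truncation
  clause only finitely many of the summands are nonzero.
\<close>

definition vertex_algebra ::
    "'v::complex_vector \<Rightarrow> ('v \<Rightarrow> int \<Rightarrow> 'v \<Rightarrow> 'v) \<Rightarrow> bool"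
  where "vertex_algebra one Y \<longleftrightarrow>
    (\<forall>n b. clinear (\<lambda>a. Y a n b)) \<and>
    (\<forall>a n. clinear (Y a n)) \<and>
    (\<forall>a b. \<exists>N. \<forall>n\<ge>N. Y a n b = 0) \<and>
    (\<forall>n b. Y one n b = (if n = -1 then b else 0)) \<and>
    (\<forall>a. Y a (-1) one = a \<and> (\<forall>n\<ge>0. Y a n one = 0)) \<and>
    (\<forall>a b c m n k.
      Sum_any (\<lambda>i::nat. (of_int m gchoose i) *\<^sub>C Y (Y a (n + int i) b) (m + k - int i) c) =
      Sum_any (\<lambda>i::nat. ((-1) ^ i * (of_int n gchoose i)) *\<^sub>C
        (Y a (m + n - int i) (Y b (k + int i) c)
          - ((-1) powi n) *\<^sub>C Y b (n + k - int i) (Y a (m + int i) c))))"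

definition vertex_automorphism ::
    "'v::complex_vector \<Rightarrow> ('v \<Rightarrow> int \<Rightarrow> 'v \<Rightarrow> 'v) \<Rightarrow> ('v \<Rightarrow> 'v) \<Rightarrow> bool"
  where "vertex_automorphism one Y \<sigma> \<longleftrightarrow>
    clinear \<sigma> \<and> bij \<sigma> \<and> \<sigma> one = one \<and> (\<forall>a n b. \<sigma> (Y a n b) = Y (\<sigma> a) n (\<sigma> b))"

definition orthonormal_basis :: "'h::quadratic_space set \<Rightarrow> bool"
  where "orthonormal_basis B \<longleftrightarrow> cindependent B \<and> cspan B = UNIV \<and>
    (\<forall>u\<in>B. \<forall>v\<in>B. \<langle>u, v\<rangle> = (if u = v then 1 else 0))"

definition conformal_vector :: "'h::quadratic_space set \<Rightarrow> 'h \<Rightarrow> 'h heis"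
  where "conformal_vector B h =
    (1/2) *\<^sub>C (\<Sum>u\<in>B. mode u (-1) (mode u (-1) vac)) + mode h (-2) vac"

definition conformal_aut ::
    "('h::quadratic_space heis \<Rightarrow> int \<Rightarrow> 'h heis \<Rightarrow> 'h heis) \<Rightarrow> 'h heis \<Rightarrow> ('h heis \<Rightarrow> 'h heis) set"
  where "conformal_aut Y \<omega> = {\<sigma>. vertex_automorphism vac Y \<sigma> \<and> \<sigma> \<omega> = \<omega>}"

text \<open>The restriction of \<open>\<sigma>\<close> to \<open>\<h>\<close>, identified with the weight-one subspace.\<close>

definition weight_one :: "'h::quadratic_space \<Rightarrow> 'h heis"
  where "weight_one u = mode u (-1) vac"

definition restrict_h :: "('h::quadratic_space heis \<Rightarrow> 'h heis) \<Rightarrow> 'h \<Rightarrow> 'h"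
  where "restrict_h \<sigma> u = (THE v. weight_one v = \<sigma> (weight_one u))"


section \<open>Regular subspaces\<close>

definition regular_subspace :: "'h::quadratic_space set \<Rightarrow> bool"
  where "regular_subspace S \<longleftrightarrow>
    csubspace S \<and> (\<forall>u\<in>S. (\<forall>v\<in>S. \<langle>u, v\<rangle> = 0) \<longrightarrow> u = 0)"

definition orth_compl :: "'h::quadratic_space set \<Rightarrow> 'h set"
  where "orth_compl S = {x. \<forall>v\<in>S. \<langle>x, v\<rangle> = 0}"

definition proj :: "'h::quadratic_space set \<Rightarrow> 'h \<Rightarrow> 'h"
  where "proj S x = (THE p. p \<in> S \<and> x - p \<in> orth_compl S)"

definition Reg :: "'h::quadratic_space \<Rightarrow> ('h set \<times> 'h) set"
  where "Reg h = {(S, h'). regular_subspace S \<and> h' = proj S h}"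

definition reg_act ::
    "('h::quadratic_space heis \<Rightarrow> 'h heis) \<Rightarrow> 'h set \<times> 'h \<Rightarrow> 'h set \<times> 'h"
  where "reg_act \<sigma> p = (restrict_h \<sigma> ` fst p, restrict_h \<sigma> (snd p))"

definition Reg_orbits ::
    "('h::quadratic_space heis \<Rightarrow> 'h heis) set \<Rightarrow> 'h \<Rightarrow> ('h set \<times> 'h) set set"
  where "Reg_orbits G h = {{reg_act \<sigma> p | \<sigma>. \<sigma> \<in> G} | p. p \<in> Reg h}"

definition I1 :: "'h::quadratic_space \<Rightarrow> nat \<Rightarrow> ('h set \<times> 'h) set"
  where "I1 h k = {(S, h') \<in> Reg h. h' = h \<and> cdim S = k}"

definition I2 :: "'h::quadratic_space \<Rightarrow> nat \<Rightarrow> ('h set \<times> 'h) set"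
  where "I2 h k = {(S, h') \<in> Reg h. h' = 0 \<and> cdim S = k}"

definition I3 :: "'h::quadratic_space \<Rightarrow> nat \<Rightarrow> complex \<Rightarrow> ('h set \<times> 'h) set"
  where "I3 h k y =
    {(S, h') \<in> Reg h. cdim S = k \<and> \<langle>h', h'\<rangle> = y \<and> h' \<noteq> 0 \<and> h' \<noteq> h}"

definition I4 :: "'h::quadratic_space \<Rightarrow> nat \<Rightarrow> ('h set \<times> 'h) set"
  where "I4 h k =
    {(S, h') \<in> Reg h. cdim S = k \<and> \<langle>h', h'\<rangle> = \<langle>h, h\<rangle> \<and> h' \<noteq> 0 \<and> h' \<noteq> h}"

definition I5 :: "'h::quadratic_space \<Rightarrow> nat \<Rightarrow> ('h set \<times> 'h) set"
  where "I5 h k = {(S, h') \<in> Reg h. cdim S = k \<and> \<langle>h', h'\<rangle> = 0 \<and> h' \<noteq> 0}"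

end

theory Submission
  imports Defs "HOL-Library.Function_Algebras" "HOL-Library.Multiset"
begin

text \<open>
  The proof has two halves that meet in the lemma \<open>restrict_h_conformal_aut\<close>: restriction to the
  weight-one subspace identifies the group \<open>G\<close> with the isometries of \<open>\<h>\<close> that fix \<open>h\<close>.

  On the vertex algebra side, the subspace \<open>\<h>\<close> is the eigenspace of \<open>L\<^sub>0 = \<omega>\<^sub>(\<^sub>1\<^sub>)\<close> with eigenvalue
  \<open>1\<close> (\<open>eigenvector_weight_one\<close>), since \<open>[L\<^sub>0, v(m)] = -m v(m)\<close> makes the words in negative modes
  eigenvectors. An automorphism fixing \<open>\<omega>\<close> therefore acts on \<open>\<h>\<close>, and it preserves the form and \<open>h\<close>
  because these can be read off from \<open>u(1) v(-1) 1 = \<langle>u, v\<rangle> 1\<close> and \<open>v(2) \<omega> = 2 \<langle>v, h\<rangle> 1\<close>. This needs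
  \<open>1 \<noteq> 0\<close> in the induced module, which a Fock space provides (\<open>vac_nonzero\<close>). Conversely the
  universal property of the induced module extends an isometry fixing \<open>h\<close> to all of \<open>V(1,0)\<close>, and the
  Borcherds identity shows that the extension respects all products (\<open>conformal_aut_lift\<close>).

  On the linear algebra side, a regular subspace has orthonormal frames, and a given vector takes one
  of the forms \<open>0\<close>, \<open>\<surd>y e\<^sub>0\<close> or \<open>e\<^sub>0 + \<i> e\<^sub>1\<close> in a suitable frame (\<open>adapted_frame\<close>). Applied to
  \<open>h'\<close> in \<open>\<h>'\<close> and to \<open>h - h'\<close> in the orthogonal complement, this shows that the dimension of \<open>\<h>'\<close>, the
  norm of \<open>h'\<close>, and the truth values of \<open>h' = 0\<close> and \<open>h' = h\<close> classify the orbits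
  (\<open>isometry_of_same_type\<close>). Which values occur is a matter of room for the two vectors in the two
  spaces (\<open>Reg_type_realized\<close>), and the resulting list consists of the five families.
\<close>

section \<open>Complex linear maps\<close>

lemma clinear_iff:
  "clinear f \<longleftrightarrow> (\<forall>x y. f (x + y) = f x + f y) \<and> (\<forall>a x. f (a *\<^sub>C x) = a *\<^sub>C f x)"
  by (simp add: Vector_Spaces.linear_iff complex_vector.vector_space_axioms)

lemma clinear_add: "clinear f \<Longrightarrow> f (x + y) = f x + f y"
  and clinear_scale: "clinear f \<Longrightarrow> f (a *\<^sub>C x) = a *\<^sub>C f x"
  by (simp_all add: clinear_iff)

lemma clinear_module_hom: "clinear f \<Longrightarrow> module_hom scaleC scaleC f"
  by (simp add: linear_iff_module_hom)

lemma clinear_zero: "clinear f \<Longrightarrow> f 0 = 0"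
  and clinear_diff: "clinear f \<Longrightarrow> f (x - y) = f x - f y"
  and clinear_sum: "clinear f \<Longrightarrow> f (sum g A) = (\<Sum>i\<in>A. f (g i))"
  by (simp_all add: module_hom.zero[OF clinear_module_hom] module_hom.diff[OF clinear_module_hom]
      module_hom.sum[OF clinear_module_hom])

lemma clinear_eq_on_span:
  assumes "clinear f" "clinear g" "\<And>x. x \<in> S \<Longrightarrow> f x = g x" "x \<in> cspan S"
  shows "f x = g x"
  using assms(4)
proof (induction rule: complex_vector.span_induct_alt)
  case base
  then show ?case using assms by (simp add: clinear_zero)
next
  case (step c x y)
  then show ?case using assms by (simp add: clinear_add clinear_scale)
qed

lemma poly_mapping_sum_singles:
  "p = (\<Sum>k\<in>Poly_Mapping.keys p. Poly_Mapping.single k (Poly_Mapping.lookup p k))"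
  by (rule poly_mapping_eqI)
    (simp add: lookup_sum lookup_single when_def in_keys_iff)

definition lin_ext :: "('w \<Rightarrow> 'v::complex_vector) \<Rightarrow> ('w \<Rightarrow>\<^sub>0 complex) \<Rightarrow> 'v"
  where "lin_ext F p = (\<Sum>w\<in>Poly_Mapping.keys p. Poly_Mapping.lookup p w *\<^sub>C F w)"

lemma lin_ext_superset:
  assumes "finite A" "Poly_Mapping.keys p \<subseteq> A"
  shows "lin_ext F p = (\<Sum>w\<in>A. Poly_Mapping.lookup p w *\<^sub>C F w)"
  unfolding lin_ext_def
  by (rule sum.mono_neutral_left[OF assms]) (simp add: in_keys_iff)

lemma clinear_lin_ext: "clinear (lin_ext F)"
  unfolding clinear_iff
proof (intro conjI allI)
  fix p q :: "'a \<Rightarrow>\<^sub>0 complex"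
  let ?A = "Poly_Mapping.keys p \<union> Poly_Mapping.keys q"
  have "Poly_Mapping.keys (p + q) \<subseteq> ?A" by (rule Poly_Mapping.keys_add)
  then show "lin_ext F (p + q) = lin_ext F p + lin_ext F q"
    by (simp add: lin_ext_superset[of ?A] lookup_add scaleC_add_left sum.distrib)
next
  fix a and p :: "'a \<Rightarrow>\<^sub>0 complex"
  have "Poly_Mapping.keys (a *\<^sub>C p) \<subseteq> Poly_Mapping.keys p"
    by (auto simp: in_keys_iff lookup_scaleC scaleC_complex_def)
  then show "lin_ext F (a *\<^sub>C p) = a *\<^sub>C lin_ext F p"
    by (simp add: lin_ext_superset[of "Poly_Mapping.keys p"] lookup_scaleC scaleC_complex_def
        complex_vector.scale_sum_right scaleC_scaleC)
qed

lemma lin_ext_word: "lin_ext F (word w) = F w"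
  by (simp add: lin_ext_def word_def scaleC_one)

section \<open>The module \<open>V(1,0)\<close>\<close>

lemma abs_heis_ex: "\<exists>p. a = abs_heis p"
  by (metis Quotient3_abs_rep[OF Quotient3_heis])

text \<open>
  The universal property of an induced module: a word acts on \<open>v0\<close> letter by letter, and the
  assumptions on \<open>\<rho>\<close> say exactly that this linear map kills the defining relations. They are
  asked for on a stable subset \<open>M\<close> only, because in the Fock space below the operators depend
  linearly on \<open>x\<close> on the multilinear functions but not on all functions. The second
  application, to \<open>V(1,0)\<close> itself with the action twisted by an isometry, produces automorphisms.
\<close>

lemma induced_module_hom:
  fixes \<rho> :: "'h::quadratic_space affine \<Rightarrow> 'v \<Rightarrow> 'v::complex_vector"
  assumes v0: "v0 \<in> M"
    and stable: "\<And>x v. v \<in> M \<Longrightarrow> \<rho> x v \<in> M"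
    and linear: "\<And>x. clinear (\<rho> x)"
    and add: "\<And>x y v. v \<in> M \<Longrightarrow> \<rho> (x + y) v = \<rho> x v + \<rho> y v"
    and scale: "\<And>a x v. v \<in> M \<Longrightarrow> \<rho> (a *\<^sub>C x) v = a *\<^sub>C \<rho> x v"
    and bracket: "\<And>x y v. v \<in> M \<Longrightarrow> \<rho> x (\<rho> y v) - \<rho> y (\<rho> x v) = \<rho> (affine_bracket x y) v"
    and nonneg: "\<And>x. x \<in> affine_nonneg \<Longrightarrow> \<rho> x v0 = snd x *\<^sub>C v0"
  obtains \<Phi> where "clinear \<Phi>" "\<Phi> vac = v0" "\<And>x a. \<Phi> (affine_act x a) = \<rho> x (\<Phi> a)"
proof -
  define F where "F w = foldr \<rho> w v0" for w
  have FM: "F w \<in> M" for w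
    by (induction w) (simp_all add: F_def v0 stable)
  have lin_foldr: "clinear (foldr \<rho> v)" for v
    by (induction v) (auto simp: clinear_iff linear[unfolded clinear_iff])
  have F_append: "F (v @ w) = foldr \<rho> v (F w)" for v w
    by (simp add: F_def)
  have F_Cons: "F (x # w) = \<rho> x (F w)" for x w
    by (simp add: F_def)
  let ?L = "lin_ext F"
  note L = clinear_lin_ext[of F]
  have kill: "?L r = 0" if "r \<in> heis_relations" for r
    using that unfolding heis_relations_def uea_relations_def inducing_relations_def
  proof (elim UnE CollectE exE conjE)
    fix v x y w
    assume "r = word (v @ (x + y) # w) - word (v @ x # w) - word (v @ y # w)"
    then show ?thesis
      by (simp add: clinear_diff[OF L] lin_ext_word F_append F_Cons add[OF FM]
          clinear_add[OF lin_foldr])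
  next
    fix v a x w
    assume "r = word (v @ (a *\<^sub>C x) # w) - a *\<^sub>C word (v @ x # w)"
    then show ?thesis
      by (simp add: clinear_diff[OF L] clinear_scale[OF L] lin_ext_word F_append F_Cons
          scale[OF FM] clinear_scale[OF lin_foldr])
  next
    fix v x y w
    assume "r = word (v @ x # y # w) - word (v @ y # x # w) - word (v @ affine_bracket x y # w)"
    then show ?thesis
      by (simp add: clinear_diff[OF L] lin_ext_word F_append F_Cons bracket[OF FM, symmetric]
          clinear_diff[OF lin_foldr])
  next
    fix w and x :: "'h affine"
    assume "r = word (w @ [x]) - snd x *\<^sub>C word w" "x \<in> affine_nonneg"
    moreover have "F [] = v0" by (simp add: F_def)
    ultimately show ?thesis
      using F_append[of w "[]"]
      by (simp add: clinear_diff[OF L] clinear_scale[OF L] lin_ext_word F_append F_Cons nonneg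
          clinear_scale[OF lin_foldr])
  qed
  have kill_span: "?L p = 0" if "p \<in> cspan heis_relations" for p
    using that
  proof (induction rule: complex_vector.span_induct_alt)
    case base
    then show ?case by (simp add: clinear_zero[OF L])
  next
    case (step c x y)
    then show ?case by (simp add: clinear_add[OF L] clinear_scale[OF L] kill)
  qed
  define \<Phi> where "\<Phi> a = ?L (rep_heis a)" for a
  have \<Phi>_abs: "\<Phi> (abs_heis p) = ?L p" for p
  proof -
    have "heis_rel (rep_heis (abs_heis p)) p"
      by (rule Quotient3_rep_abs[OF Quotient3_heis heis_rel_refl])
    then have "?L (rep_heis (abs_heis p) - p) = 0"
      unfolding heis_rel_def by (rule kill_span)
    then show ?thesis by (simp add: \<Phi>_def clinear_diff[OF L])
  qed
  have L_left_mult: "?L (left_mult x p) = \<rho> x (?L p)" for x p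
    unfolding left_mult_def
    by (simp add: clinear_sum[OF L] clinear_scale[OF L] lin_ext_word F_Cons lin_ext_def[of F p]
        clinear_sum[OF linear] clinear_scale[OF linear])
  show ?thesis
  proof
    show "clinear \<Phi>"
      unfolding clinear_iff
    proof (intro conjI allI)
      fix a b :: "'h heis"
      obtain p q where "a = abs_heis p" "b = abs_heis q" using abs_heis_ex by metis
      then show "\<Phi> (a + b) = \<Phi> a + \<Phi> b"
        by (simp add: plus_heis.abs_eq \<Phi>_abs clinear_add[OF L])
    next
      fix c and a :: "'h heis"
      obtain p where "a = abs_heis p" using abs_heis_ex by metis
      then show "\<Phi> (c *\<^sub>C a) = c *\<^sub>C \<Phi> a"
        by (simp add: scaleC_heis.abs_eq \<Phi>_abs clinear_scale[OF L])
    qed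
    show "\<Phi> vac = v0"
      by (simp add: vac.abs_eq \<Phi>_abs lin_ext_word F_def)
    fix x :: "'h affine" and a :: "'h heis"
    obtain p where "a = abs_heis p" using abs_heis_ex by metis
    then show "\<Phi> (affine_act x a) = \<rho> x (\<Phi> a)"
      by (simp add: affine_act_abs \<Phi>_abs L_left_mult)
  qed
qed

lemma abs_heis_eq: "p - q \<in> cspan heis_relations \<Longrightarrow> abs_heis p = abs_heis q"
  by (simp add: heis.abs_eq_iff heis_rel_def)

lemma clinear_abs_heis: "clinear abs_heis"
  by (simp add: clinear_iff plus_heis.abs_eq scaleC_heis.abs_eq)

lemma clinear_affine_act: "clinear (affine_act x)"
  unfolding clinear_iff
proof (intro conjI allI)
  fix a b :: "'a heis"
  obtain p q where "a = abs_heis p" "b = abs_heis q" using abs_heis_ex by metis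
  then show "affine_act x (a + b) = affine_act x a + affine_act x b"
    by (simp add: affine_act_abs plus_heis.abs_eq left_mult_add)
next
  fix c and a :: "'a heis"
  obtain p where "a = abs_heis p" using abs_heis_ex by metis
  then show "affine_act x (c *\<^sub>C a) = c *\<^sub>C affine_act x a"
    by (simp add: affine_act_abs scaleC_heis.abs_eq left_mult_scaleC)
qed

lemmas affine_act_clinear = clinear_add[OF clinear_affine_act] clinear_scale[OF clinear_affine_act]

lemma affine_act_word: "affine_act x (abs_heis (word w)) = abs_heis (word (x # w))"
  by (simp add: affine_act_abs left_mult_word)

lemma heis_in_span_words: "a \<in> cspan (range (\<lambda>w. abs_heis (word w)))"
proof -
  obtain p where p: "a = abs_heis p" using abs_heis_ex by metis
  have "p = (\<Sum>w\<in>Poly_Mapping.keys p. Poly_Mapping.lookup p w *\<^sub>C word w)"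
    by (subst poly_mapping_sum_singles[of p], rule sum.cong)
      (simp_all add: word_def poly_mapping_eqI lookup_scaleC scaleC_complex_def lookup_single when_def)
  then have "a = (\<Sum>w\<in>Poly_Mapping.keys p. Poly_Mapping.lookup p w *\<^sub>C abs_heis (word w))"
    unfolding p by (metis (no_types, lifting) clinear_abs_heis[THEN clinear_scale]
        clinear_abs_heis[THEN clinear_sum] sum.cong)
  also have "\<dots> \<in> cspan (range (\<lambda>w. abs_heis (word w)))"
    by (intro complex_vector.span_sum complex_vector.span_scale complex_vector.span_base rangeI)
  finally show ?thesis .
qed

lemma eq_on_words:
  assumes "clinear f" "clinear g" "\<And>w. f (abs_heis (word w)) = g (abs_heis (word w))"
  shows "f a = g a"
  by (rule clinear_eq_on_span[OF assms(1,2) _ heis_in_span_words[of a]]) (use assms(3) in auto)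

lemma affine_act_add: "affine_act (x + y) a = affine_act x a + affine_act y a"
proof (rule eq_on_words[where f = "affine_act (x + y)" and g = "\<lambda>a. affine_act x a + affine_act y a"])
  fix w :: "'a affine list"
  have "word ([] @ (x + y) # w) - word ([] @ x # w) - word ([] @ y # w) \<in> heis_relations"
    unfolding heis_relations_def uea_relations_def by blast
  then have "abs_heis (word ((x + y) # w)) = abs_heis (word (x # w) + word (y # w))"
    by (intro abs_heis_eq) (simp add: complex_vector.span_base diff_diff_add)
  then show "affine_act (x + y) (abs_heis (word w)) =
      affine_act x (abs_heis (word w)) + affine_act y (abs_heis (word w))"
    by (simp add: affine_act_word plus_heis.abs_eq)
qed (simp_all add: clinear_iff affine_act_clinear scaleC_add_right algebra_simps)

lemma affine_act_scale: "affine_act (c *\<^sub>C x) a = c *\<^sub>C affine_act x a"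
proof (rule eq_on_words[where f = "affine_act (c *\<^sub>C x)" and g = "\<lambda>a. c *\<^sub>C affine_act x a"])
  fix w :: "'a affine list"
  have "word ([] @ (c *\<^sub>C x) # w) - c *\<^sub>C word ([] @ x # w) \<in> heis_relations"
    unfolding heis_relations_def uea_relations_def by blast
  then have "abs_heis (word ((c *\<^sub>C x) # w)) = abs_heis (c *\<^sub>C word (x # w))"
    by (intro abs_heis_eq) (simp add: complex_vector.span_base)
  then show "affine_act (c *\<^sub>C x) (abs_heis (word w)) = c *\<^sub>C affine_act x (abs_heis (word w))"
    by (simp add: affine_act_word scaleC_heis.abs_eq)
qed (simp_all add: clinear_iff affine_act_clinear scaleC_add_right scaleC_scaleC mult.commute)

lemma affine_act_bracket:
  "affine_act x (affine_act y a) - affine_act y (affine_act x a) = affine_act (affine_bracket x y) a"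
proof (rule eq_on_words[where f = "\<lambda>a. affine_act x (affine_act y a) - affine_act y (affine_act x a)"
      and g = "affine_act (affine_bracket x y)"])
  fix w :: "'a affine list"
  have "word ([] @ x # y # w) - word ([] @ y # x # w) - word ([] @ affine_bracket x y # w) \<in> heis_relations"
    unfolding heis_relations_def uea_relations_def by blast
  then have "abs_heis (word (x # y # w) - word (y # x # w)) = abs_heis (word (affine_bracket x y # w))"
    by (intro abs_heis_eq) (simp add: complex_vector.span_base)
  then show "affine_act x (affine_act y (abs_heis (word w))) - affine_act y (affine_act x (abs_heis (word w)))
      = affine_act (affine_bracket x y) (abs_heis (word w))"
    by (simp add: affine_act_word minus_heis.abs_eq)
qed (simp_all add: clinear_iff affine_act_clinear algebra_simps complex_vector.scale_right_diff_distrib)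

lemma affine_act_vac: "x \<in> affine_nonneg \<Longrightarrow> affine_act x vac = snd x *\<^sub>C vac"
proof -
  assume "x \<in> affine_nonneg"
  then have "word ([] @ [x]) - snd x *\<^sub>C word [] \<in> heis_relations"
    unfolding heis_relations_def inducing_relations_def by blast
  then have "abs_heis (word [x]) = abs_heis (snd x *\<^sub>C word [])"
    by (intro abs_heis_eq) (simp add: complex_vector.span_base)
  then show ?thesis
    by (simp add: vac.abs_eq affine_act_word scaleC_heis.abs_eq)
qed

lemma affine_act_induct [case_names zero add scale vac act]:
  assumes "P 0" "\<And>a b. P a \<Longrightarrow> P b \<Longrightarrow> P (a + b)" "\<And>c a. P a \<Longrightarrow> P (c *\<^sub>C a)"
    and "P vac" "\<And>x a. P a \<Longrightarrow> P (affine_act x a)"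
  shows "P a"
proof -
  have words: "P (abs_heis (word w))" for w
    by (induction w) (simp_all add: assms(4,5) flip: affine_act_word vac.abs_eq)
  show ?thesis
    using heis_in_span_words[of a]
    by (induction rule: complex_vector.span_induct_alt) (auto simp: assms(1-3) words)
qed

text \<open>The operator of \<open>C\<close> commutes with the action and fixes \<open>1\<close>, which generates the module.\<close>
lemma affine_act_central: "affine_act (0, c) a = c *\<^sub>C a"
proof (induction a rule: affine_act_induct)
  case zero
  then show ?case by (simp add: clinear_zero[OF clinear_affine_act])
next
  case (add a b)
  then show ?case by (simp add: clinear_add[OF clinear_affine_act] scaleC_add_right)
next
  case (scale c a)
  then show ?case by (simp add: clinear_scale[OF clinear_affine_act] scaleC_scaleC mult.commute)
next
  case vac
  then show ?case by (simp add: affine_act_vac affine_nonneg_def)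
next
  case (act x a)
  have "affine_act (0, c) (affine_act x a) - affine_act x (affine_act (0, c) a) = affine_act 0 a"
    by (simp add: affine_act_bracket affine_bracket_def zero_prod_def)
  moreover have "affine_act 0 a = 0"
    using affine_act_scale[of 0 0 a] by simp
  ultimately show ?case
    by (simp add: act clinear_scale[OF clinear_affine_act])
qed

lemma clinear_mode: "clinear (mode u n)"
  unfolding mode_def by (rule clinear_affine_act)

lemma affine_elem_add: "affine_elem (u + v) n = affine_elem u n + affine_elem v n"
  by (simp add: affine_elem_def single_add)

lemma affine_elem_scale: "affine_elem (c *\<^sub>C u) n = c *\<^sub>C affine_elem u n"
  by (simp add: affine_elem_def scaleC_prod_def)
    (rule poly_mapping_eqI, simp add: lookup_scaleC lookup_single when_def)

lemma clinear_mode_left: "clinear (\<lambda>u. mode u n a)"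
  by (simp add: clinear_iff mode_def affine_elem_add affine_elem_scale affine_act_add affine_act_scale)

lemma form_add_right: "\<langle>x, y + z\<rangle> = \<langle>x, y\<rangle> + \<langle>x, z\<rangle>"
  by (metis form_add_left form_sym)

lemma form_scale_right: "\<langle>x, c *\<^sub>C y\<rangle> = c * \<langle>x, y\<rangle>"
  by (metis form_scale_left form_sym)

lemma clinear_form_left: "clinear (\<lambda>x. \<langle>x, y\<rangle>)"
  and clinear_form_right: "clinear (\<lambda>y. \<langle>x, y\<rangle>)"
  by (simp_all add: clinear_iff form_add_left form_add_right form_scale_left form_scale_right
      scaleC_complex_def)

lemmas form_zero_left [simp] = clinear_zero[OF clinear_form_left]
  and form_zero_right [simp] = clinear_zero[OF clinear_form_right]
  and form_diff_left = clinear_diff[OF clinear_form_left]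
  and form_diff_right = clinear_diff[OF clinear_form_right]
  and form_sum_left = clinear_sum[OF clinear_form_left]
  and form_sum_right = clinear_sum[OF clinear_form_right]

lemma mode_commutator:
  "mode u m (mode v n a) - mode v n (mode u m a) = (if m + n = 0 then of_int m * \<langle>u, v\<rangle> else 0) *\<^sub>C a"
proof -
  have "affine_bracket (affine_elem u m) (affine_elem v n) =
      (0, if m + n = 0 then of_int m * \<langle>u, v\<rangle> else 0)"
    by (auto simp: affine_bracket_def affine_elem_def lookup_single when_def)
  then show ?thesis
    unfolding mode_def affine_act_bracket by (simp only: affine_act_central)
qed

lemma mode_vac: "n \<ge> 0 \<Longrightarrow> mode u n vac = 0"
  unfolding mode_def
  by (subst affine_act_vac) (auto simp: affine_nonneg_def affine_elem_def lookup_single when_def)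

lemma affine_act_modes:
  "affine_act x a = (\<Sum>n\<in>Poly_Mapping.keys (fst x). mode (Poly_Mapping.lookup (fst x) n) n a) + snd x *\<^sub>C a"
proof -
  have sum: "affine_act (\<Sum>n\<in>A. affine_elem (f n) n) a = (\<Sum>n\<in>A. mode (f n) n a)" if "finite A" for A f
    using that
  proof (induction A)
    case empty
    then show ?case using affine_act_scale[of 0 0 a] by simp
  next
    case (insert x F)
    then show ?case by (simp add: affine_act_add mode_def)
  qed
  have fst_sum: "fst (\<Sum>n\<in>A. g n) = (\<Sum>n\<in>A. fst (g n))" "snd (\<Sum>n\<in>A. g n) = (\<Sum>n\<in>A. snd (g n))"
    for A and g :: "int \<Rightarrow> 'a affine"
    by (induction A rule: infinite_finite_induct) auto
  have "x = (\<Sum>n\<in>Poly_Mapping.keys (fst x). affine_elem (Poly_Mapping.lookup (fst x) n) n) + (0, snd x)"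
    using poly_mapping_sum_singles[of "fst x"]
    by (simp add: prod_eq_iff fst_sum affine_elem_def)
  then have "affine_act x a = affine_act
      ((\<Sum>n\<in>Poly_Mapping.keys (fst x). affine_elem (Poly_Mapping.lookup (fst x) n) n) + (0, snd x)) a"
    by (rule arg_cong)
  then show ?thesis
    by (simp only: affine_act_add affine_act_central sum[OF finite_keys])
qed

text \<open>The modes alone generate the module from the vacuum, since \<open>C\<close> acts by a scalar.\<close>
lemma mode_induct [case_names zero add scale vac mode]:
  assumes "P 0" "\<And>a b. P a \<Longrightarrow> P b \<Longrightarrow> P (a + b)" "\<And>c a. P a \<Longrightarrow> P (c *\<^sub>C a)"
    and "P vac" "\<And>u n a. P a \<Longrightarrow> P (mode u n a)"
  shows "P a"
proof (induction a rule: affine_act_induct)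
  case (act x a)
  have "P (\<Sum>n\<in>A. mode (f n) n a)" for A f
    by (induction A rule: infinite_finite_induct) (auto simp: assms(1,2,5) act)
  then show ?case by (simp add: affine_act_modes assms(2,3) act)
qed (use assms in auto)

section \<open>A Fock space and the nonvanishing of the vacuum\<close>

text \<open>
  A module given by generators and relations could collapse. Mapping \<open>V(1,0)\<close> to a concrete module
  shows that the vacuum survives, and this is all that is needed: nondegeneracy of the form then
  makes \<open>u \<mapsto> u(-1)1\<close> injective. The concrete module consists of functions of finite multisets of
  Laurent polynomials, additive and homogeneous in every argument. The Laurent part
  of an element acts by inserting it as a further argument and by the sum over all ways of contracting
  one argument with it; \<open>C\<close> acts by \<open>1\<close>. Working with multisets makes all functions symmetric, so insertions commute.
\<close>

instantiation "fun" :: (type, complex_vector) complex_vector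
begin
definition "scaleC_fun a (f :: 'a \<Rightarrow> 'b) = (\<lambda>x. a *\<^sub>C f x)"
instance
  by standard (simp_all add: scaleC_fun_def fun_eq_iff scaleC_add_right scaleC_add_left scaleC_scaleC scaleC_one)
end

lemma scaleC_fun_apply: "(a *\<^sub>C f) x = a *\<^sub>C f x"
  by (simp add: scaleC_fun_def)

text \<open>
  Half of the cocycle of the bracket: only the negative modes of the first argument contribute, so
  that contraction with an element of the nonnegative part is zero. The cocycle is recovered by
  antisymmetrisation in \<open>fock_pair_bracket\<close>.
\<close>

definition fock_pair :: "(int \<Rightarrow>\<^sub>0 'h::quadratic_space) \<Rightarrow> (int \<Rightarrow>\<^sub>0 'h) \<Rightarrow> complex"
  where "fock_pair f g = - (\<Sum>m\<in>Poly_Mapping.keys f. if m < 0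
     then of_int m * \<langle>Poly_Mapping.lookup f m, Poly_Mapping.lookup g (- m)\<rangle> else 0)"

lemma fock_pair_superset:
  assumes "finite A" "Poly_Mapping.keys f \<subseteq> A"
  shows "fock_pair f g = - (\<Sum>m\<in>A. if m < 0
     then of_int m * \<langle>Poly_Mapping.lookup f m, Poly_Mapping.lookup g (- m)\<rangle> else 0)"
  unfolding fock_pair_def neg_equal_iff_equal
  by (rule sum.mono_neutral_left[OF assms]) (simp add: in_keys_iff)

lemma fock_pair_add_right: "fock_pair f (g + g') = fock_pair f g + fock_pair f g'"
proof -
  let ?s = "\<lambda>g m. if m < 0 then of_int m * \<langle>Poly_Mapping.lookup f m, Poly_Mapping.lookup g (- m)\<rangle> else 0"
  have "?s (g + g') m = ?s g m + ?s g' m" for m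
    by (simp add: lookup_add form_add_right algebra_simps)
  then show ?thesis by (simp only: fock_pair_def sum.distrib minus_add_distrib)
qed

lemma fock_pair_scale_right: "fock_pair f (c *\<^sub>C g) = c * fock_pair f g"
proof -
  let ?s = "\<lambda>g m. if m < 0 then of_int m * \<langle>Poly_Mapping.lookup f m, Poly_Mapping.lookup g (- m)\<rangle> else 0"
  have "?s (c *\<^sub>C g) m = c * ?s g m" for m
    by (simp add: lookup_scaleC form_scale_right algebra_simps)
  then show ?thesis by (simp only: fock_pair_def sum_distrib_left[symmetric] mult_minus_right)
qed

lemma fock_pair_add_left: "fock_pair (f + f') g = fock_pair f g + fock_pair f' g"
proof -
  let ?A = "Poly_Mapping.keys f \<union> Poly_Mapping.keys f'"
  let ?s = "\<lambda>f m. if m < 0 then of_int m * \<langle>Poly_Mapping.lookup f m, Poly_Mapping.lookup g (- m)\<rangle> else 0"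
  have *: "fock_pair f'' g = - (\<Sum>m\<in>?A. ?s f'' m)" if "Poly_Mapping.keys f'' \<subseteq> ?A" for f''
    by (rule fock_pair_superset) (use that in auto)
  have "?s (f + f') m = ?s f m + ?s f' m" for m
    by (simp add: lookup_add form_add_left algebra_simps)
  then show ?thesis
    using *[of f] *[of f'] *[of "f + f'"] Poly_Mapping.keys_add[of f f']
    by (simp add: sum.distrib)
qed

lemma fock_pair_scale_left: "fock_pair (c *\<^sub>C f) g = c * fock_pair f g"
proof -
  let ?s = "\<lambda>f m. if m < 0 then of_int m * \<langle>Poly_Mapping.lookup f m, Poly_Mapping.lookup g (- m)\<rangle> else 0"
  have "Poly_Mapping.keys (c *\<^sub>C f) \<subseteq> Poly_Mapping.keys f"
    by (auto simp: in_keys_iff lookup_scaleC)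
  then have "fock_pair (c *\<^sub>C f) g = - (\<Sum>m\<in>Poly_Mapping.keys f. ?s (c *\<^sub>C f) m)"
    by (intro fock_pair_superset) auto
  also have "?s (c *\<^sub>C f) m = c * ?s f m" for m
    by (simp add: lookup_scaleC form_scale_left algebra_simps)
  then have "(\<Sum>m\<in>Poly_Mapping.keys f. ?s (c *\<^sub>C f) m) = c * (\<Sum>m\<in>Poly_Mapping.keys f. ?s f m)"
    by (simp only: sum_distrib_left[symmetric])
  finally show ?thesis by (simp add: fock_pair_def)
qed

lemma fock_pair_bracket: "fock_pair (fst y) (fst x) - fock_pair (fst x) (fst y) = snd (affine_bracket x y)"
proof -
  let ?K = "Poly_Mapping.keys (fst x) \<union> Poly_Mapping.keys (fst y)"
  let ?A = "?K \<union> uminus ` ?K"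
  let ?f = "Poly_Mapping.lookup (fst x)" and ?g = "Poly_Mapping.lookup (fst y)"
  have xy: "fock_pair (fst x) (fst y) = - (\<Sum>m\<in>?A. if m < 0 then of_int m * \<langle>?f m, ?g (- m)\<rangle> else 0)"
    by (rule fock_pair_superset) auto
  have "fock_pair (fst y) (fst x) = - (\<Sum>m\<in>?A. if m < 0 then of_int m * \<langle>?g m, ?f (- m)\<rangle> else 0)"
    by (rule fock_pair_superset) auto
  also have "\<dots> = - (\<Sum>m\<in>?A. if 0 < m then - of_int m * \<langle>?f m, ?g (- m)\<rangle> else 0)"
    unfolding neg_equal_iff_equal
    by (rule sum.reindex_bij_witness[of _ uminus uminus]) (auto simp: form_sym)
  also have "\<dots> - fock_pair (fst x) (fst y) = (\<Sum>m\<in>?A. of_int m * \<langle>?f m, ?g (- m)\<rangle>)"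
    unfolding xy sum_negf[symmetric] sum_subtractf[symmetric] by (rule sum.cong) auto
  also have "\<dots> = (\<Sum>m\<in>Poly_Mapping.keys (fst x). of_int m * \<langle>?f m, ?g (- m)\<rangle>)"
    by (rule sum.mono_neutral_right) (auto simp: in_keys_iff)
  finally show ?thesis by (simp add: affine_bracket_def)
qed

type_synonym 'h fock = "(int \<Rightarrow>\<^sub>0 'h) multiset \<Rightarrow> complex"

definition annih :: "(int \<Rightarrow>\<^sub>0 'h) \<Rightarrow> 'h fock \<Rightarrow> 'h fock"
  where "annih f \<phi> W = \<phi> (add_mset f W)"

definition create :: "(int \<Rightarrow>\<^sub>0 'h::quadratic_space) \<Rightarrow> 'h fock \<Rightarrow> 'h fock"
  where "create f \<phi> W = (\<Sum>g\<in>#W. fock_pair f g * \<phi> (W - {#g#}))"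

definition fock_act :: "'h::quadratic_space affine \<Rightarrow> 'h fock \<Rightarrow> 'h fock"
  where "fock_act x \<phi> = annih (fst x) \<phi> + create (fst x) \<phi> + snd x *\<^sub>C \<phi>"

definition multilinear :: "'h::quadratic_space fock \<Rightarrow> bool"
  where "multilinear \<phi> \<longleftrightarrow> (\<forall>W. clinear (\<lambda>f. \<phi> (add_mset f W)))"

lemma multilinear_iff: "multilinear \<phi> \<longleftrightarrow>
   (\<forall>f g. annih (f + g) \<phi> = annih f \<phi> + annih g \<phi>) \<and> (\<forall>c f. annih (c *\<^sub>C f) \<phi> = c *\<^sub>C annih f \<phi>)"
  by (auto simp: multilinear_def clinear_iff annih_def fun_eq_iff scaleC_fun_apply)

lemma clinear_annih: "clinear (annih f)"
  by (simp add: clinear_iff annih_def fun_eq_iff scaleC_fun_apply)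

lemma clinear_create: "clinear (create f)"
  by (simp add: clinear_iff create_def fun_eq_iff scaleC_fun_apply scaleC_complex_def sum_mset.distrib
      sum_mset_distrib_left algebra_simps)

lemma annih_commute: "annih f (annih g \<phi>) = annih g (annih f \<phi>)"
  by (simp add: annih_def fun_eq_iff add_mset_commute)

text \<open>
  The canonical commutation relation: a contraction in the presence of the inserted argument \<open>g\<close>
  hits either \<open>g\<close> itself or one of the other arguments.
\<close>
lemma annih_create: "annih g (create f \<phi>) = fock_pair f g *\<^sub>C \<phi> + create f (annih g \<phi>)"
proof
  fix W
  have "(\<Sum>z\<in>#W. fock_pair f z * \<phi> (add_mset g W - {#z#})) =
      (\<Sum>z\<in>#W. fock_pair f z * \<phi> (add_mset g (W - {#z#})))"
    by (intro arg_cong[of _ _ sum_mset] image_mset_cong) simp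
  then show "annih g (create f \<phi>) W = (fock_pair f g *\<^sub>C \<phi> + create f (annih g \<phi>)) W"
    by (simp add: annih_def create_def scaleC_fun_apply scaleC_complex_def)
qed

text \<open>
  Peeling one element off the multiset with \<open>annih_create\<close> produces an expression symmetric in the
  two operators; this avoids a double sum over pairs of contracted arguments.
\<close>
lemma create_commute: "create f (create g \<phi>) = create g (create f \<phi>)"
proof
  fix W
  show "create f (create g \<phi>) W = create g (create f \<phi>) W"
  proof (induction W arbitrary: \<phi>)
    case empty
    then show ?case by (simp add: create_def)
  next
    case (add z W)
    have step: "annih z (create f (create g \<phi>)) = fock_pair f z *\<^sub>C create g \<phi>
        + fock_pair g z *\<^sub>C create f \<phi> + create f (create g (annih z \<phi>))" for f g
      by (simp add: annih_create clinear_add[OF clinear_create] clinear_scale[OF clinear_create])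
    have "annih z (create f (create g \<phi>)) W = annih z (create g (create f \<phi>)) W"
      unfolding step by (simp add: add.IH)
    then show ?case by (simp add: annih_def)
  qed
qed

lemma create_add_left: "create (f + f') \<phi> = create f \<phi> + create f' \<phi>"
  by (simp add: create_def fun_eq_iff fock_pair_add_left sum_mset.distrib algebra_simps)

lemma create_scale_left: "create (c *\<^sub>C f) \<phi> = c *\<^sub>C create f \<phi>"
  by (simp add: create_def fun_eq_iff fock_pair_scale_left scaleC_fun_apply scaleC_complex_def
      sum_mset_distrib_left algebra_simps)

lemma clinear_fock_act: "clinear (fock_act x)"
  by (simp add: clinear_iff fock_act_def clinear_add[OF clinear_annih] clinear_add[OF clinear_create]
      clinear_scale[OF clinear_annih] clinear_scale[OF clinear_create]
      scaleC_add_right scaleC_scaleC mult.commute)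

text \<open>
  Only the mixed commutators of insertion and contraction survive, and they add up to the cocycle.
  Multilinearity enters because the bracket has zero Laurent part, so that inserting it must give \<open>0\<close>.
\<close>
lemma fock_act_bracket:
  assumes "multilinear \<phi>"
  shows "fock_act x (fock_act y \<phi>) - fock_act y (fock_act x \<phi>) = fock_act (affine_bracket x y) \<phi>"
proof -
  have *: "fock_act x (fock_act y \<phi>) =
      annih (fst x) (annih (fst y) \<phi>) + create (fst x) (create (fst y) \<phi>)
      + create (fst y) (annih (fst x) \<phi>) + create (fst x) (annih (fst y) \<phi>)
      + snd y *\<^sub>C annih (fst x) \<phi> + snd x *\<^sub>C annih (fst y) \<phi>
      + snd y *\<^sub>C create (fst x) \<phi> + snd x *\<^sub>C create (fst y) \<phi>
      + (snd x * snd y) *\<^sub>C \<phi> + fock_pair (fst y) (fst x) *\<^sub>C \<phi>" for x y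
    by (simp add: fock_act_def clinear_add[OF clinear_annih] clinear_add[OF clinear_create]
      clinear_scale[OF clinear_annih] clinear_scale[OF clinear_create] annih_create
      scaleC_add_right scaleC_scaleC algebra_simps)
  have "fock_act x (fock_act y \<phi>) - fock_act y (fock_act x \<phi>)
      = fock_pair (fst y) (fst x) *\<^sub>C \<phi> - fock_pair (fst x) (fst y) *\<^sub>C \<phi>"
    unfolding * by (simp add: annih_commute[of "fst y"] create_commute[of "fst y"] mult.commute)
  also have "\<dots> = snd (affine_bracket x y) *\<^sub>C \<phi>"
    by (simp add: fock_pair_bracket[symmetric] complex_vector.scale_left_diff_distrib)
  also have "annih 0 \<phi> = 0" "create 0 \<phi> = 0"
    using assms create_scale_left[of 0 0 \<phi>] unfolding multilinear_iff
    by (metis complex_vector.scale_zero_left)+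
  then have "snd (affine_bracket x y) *\<^sub>C \<phi> = fock_act (affine_bracket x y) \<phi>"
    by (simp add: fock_act_def affine_bracket_def)
  finally show ?thesis .
qed

lemma multilinear_fock_act: "multilinear \<phi> \<Longrightarrow> multilinear (fock_act x \<phi>)"
  unfolding multilinear_iff fock_act_def
  by (simp add: clinear_add[OF clinear_annih] clinear_add[OF clinear_create]
      clinear_scale[OF clinear_annih] clinear_scale[OF clinear_create] annih_create
      annih_commute[of _ "fst x"] fock_pair_add_right fock_pair_scale_right
      scaleC_add_left scaleC_add_right scaleC_scaleC mult.commute)

lemma vac_nonzero: "vac \<noteq> (0 :: 'h::quadratic_space heis)"
proof -
  define v0 :: "'h fock" where "v0 W = (if W = {#} then 1 else 0)" for W
  have annih_v0: "annih f v0 = 0" for f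
    by (simp add: annih_def v0_def fun_eq_iff)
  obtain \<Phi> :: "'h heis \<Rightarrow> 'h fock" where \<Phi>: "clinear \<Phi>" "\<Phi> vac = v0"
  proof (rule induced_module_hom[where \<rho> = fock_act and M = "Collect multilinear" and ?v0.0 = v0])
    show "v0 \<in> Collect multilinear"
      by (simp add: multilinear_iff annih_v0)
    show "fock_act x v0 = snd x *\<^sub>C v0" if "x \<in> affine_nonneg" for x :: "'h affine"
    proof -
      have "fock_pair (fst x) g = 0" for g
        using that by (auto simp: fock_pair_def affine_nonneg_def intro: sum.neutral)
      then show ?thesis
        by (simp add: fock_act_def annih_v0 create_def fun_eq_iff)
    qed
    show "fock_act (x + y) v = fock_act x v + fock_act y v" if "v \<in> Collect multilinear"
      for x y and v :: "'h fock"
      using that by (simp add: multilinear_iff fock_act_def create_add_left scaleC_add_left)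
    show "fock_act (a *\<^sub>C x) v = a *\<^sub>C fock_act x v" if "v \<in> Collect multilinear"
      for a x and v :: "'h fock"
      using that by (simp add: multilinear_iff fock_act_def create_scale_left scaleC_add_right
          scaleC_scaleC scaleC_prod_def scaleC_complex_def)
  qed (use fock_act_bracket multilinear_fock_act clinear_fock_act in auto)
  have "v0 {#} \<noteq> 0" by (simp add: v0_def)
  then show ?thesis using \<Phi> clinear_zero by (metis zero_fun_apply)
qed

section \<open>Isometries and orthonormal bases\<close>

definition form_isometry :: "('h::quadratic_space \<Rightarrow> 'h) \<Rightarrow> bool"
  where "form_isometry g \<longleftrightarrow> clinear g \<and> bij g \<and> (\<forall>x y. \<langle>g x, g y\<rangle> = \<langle>x, y\<rangle>)"

lemma form_isometry_inv:
  assumes "form_isometry g"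
  shows "form_isometry (inv g)"
proof -
  have g: "clinear g" "bij g" "\<And>x y. \<langle>g x, g y\<rangle> = \<langle>x, y\<rangle>"
    using assms by (auto simp: form_isometry_def)
  have gi: "g (inv g x) = x" for x
    using g(2) by (simp add: bij_is_surj surj_f_inv_f)
  have inj: "x = y" if "g x = g y" for x y
    using g(2) that by (meson bij_is_inj injD)
  have "clinear (inv g)"
    unfolding clinear_iff
    by (intro conjI allI; rule inj) (simp_all add: gi clinear_add[OF g(1)] clinear_scale[OF g(1)])
  moreover have "\<langle>inv g x, inv g y\<rangle> = \<langle>x, y\<rangle>" for x y
    by (metis g(3) gi)
  ultimately show ?thesis
    using g(2) by (simp add: form_isometry_def bij_imp_bij_inv)
qed

lemma finite_independent:
  assumes "cindependent (S :: 'h::quadratic_space set)"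
  shows "finite S"
proof -
  obtain T :: "'h set" where T: "finite T" "\<And>x. \<exists>c. x = (\<Sum>b\<in>T. c b *\<^sub>C b)"
    using finite_dimensional by blast
  have "x \<in> cspan T" for x
    using T(2)[of x] by (auto intro: complex_vector.span_sum complex_vector.span_scale complex_vector.span_base)
  then show ?thesis
    using complex_vector.independent_span_bound[OF T(1) assms] by auto
qed

lemma orthonormal_expansion:
  assumes "finite B" "\<And>u v. u \<in> B \<Longrightarrow> v \<in> B \<Longrightarrow> \<langle>u, v\<rangle> = (if u = v then 1 else 0)" "x \<in> cspan B"
  shows "x = (\<Sum>b\<in>B. \<langle>x, b\<rangle> *\<^sub>C b)"
proof (rule clinear_eq_on_span[OF _ _ _ assms(3)])
  show "clinear (\<lambda>x. x)" by (simp add: clinear_iff)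
  show "clinear (\<lambda>x. \<Sum>b\<in>B. \<langle>x, b\<rangle> *\<^sub>C b)"
    by (simp add: clinear_iff form_add_left form_scale_left scaleC_add_left sum.distrib
        complex_vector.scale_sum_right scaleC_scaleC)
  fix b assume "b \<in> B"
  then have "(\<Sum>b'\<in>B. \<langle>b, b'\<rangle> *\<^sub>C b') = (\<Sum>b'\<in>B. if b = b' then b' else 0)"
    by (intro sum.cong) (auto simp: assms(2) scaleC_one)
  then show "b = (\<Sum>b'\<in>B. \<langle>b, b'\<rangle> *\<^sub>C b')"
    using assms(1) \<open>b \<in> B\<close> by simp
qed

lemma orthonormal_basis_expansion:
  assumes "orthonormal_basis B"
  shows "finite B" "x = (\<Sum>b\<in>B. \<langle>x, b\<rangle> *\<^sub>C b)" "(\<Sum>b\<in>B. \<langle>x, b\<rangle> * \<langle>y, b\<rangle>) = \<langle>x, y\<rangle>"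
proof -
  show fin: "finite B" using assms finite_independent by (auto simp: orthonormal_basis_def)
  show exp: "x = (\<Sum>b\<in>B. \<langle>x, b\<rangle> *\<^sub>C b)" for x
    using assms by (intro orthonormal_expansion fin) (auto simp: orthonormal_basis_def)
  have "\<langle>x, y\<rangle> = \<langle>x, \<Sum>b\<in>B. \<langle>y, b\<rangle> *\<^sub>C b\<rangle>" by (simp only: exp[of y, symmetric])
  then show "(\<Sum>b\<in>B. \<langle>x, b\<rangle> * \<langle>y, b\<rangle>) = \<langle>x, y\<rangle>"
    by (simp add: form_sum_right form_scale_right mult.commute)
qed

section \<open>The weight-one subspace\<close>

lemmas mode_linear = clinear_add[OF clinear_mode] clinear_scale[OF clinear_mode]
  clinear_zero[OF clinear_mode] clinear_sum[OF clinear_mode]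
  clinear_add[OF clinear_mode_left] clinear_scale[OF clinear_mode_left]
  clinear_zero[OF clinear_mode_left] clinear_sum[OF clinear_mode_left]

lemma mode_commute:
  "mode u m (mode v n a) = mode v n (mode u m a) + (if m + n = 0 then of_int m * \<langle>u, v\<rangle> else 0) *\<^sub>C a"
  using mode_commutator[of u m v n a] by (simp add: algebra_simps)

text \<open>The form is visible in the vertex algebra as \<open>u(1) v(-1) 1\<close>.\<close>
lemma mode_one_weight_one: "mode u 1 (weight_one v) = \<langle>u, v\<rangle> *\<^sub>C vac"
  unfolding weight_one_def by (subst mode_commute) (simp add: mode_vac mode_linear)

lemma clinear_weight_one: "clinear weight_one"
  using clinear_mode_left[of "-1" vac] by (simp add: weight_one_def[abs_def])

lemma weight_one_inject: "weight_one u = weight_one v \<longleftrightarrow> u = v"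
proof
  assume "weight_one u = weight_one v"
  then have "\<langle>x, u\<rangle> *\<^sub>C vac = \<langle>x, v\<rangle> *\<^sub>C (vac :: 'a heis)" for x
    by (metis mode_one_weight_one)
  then have "\<langle>u - v, x\<rangle> = 0" for x
    using vac_nonzero[where 'h = 'a] by (simp add: form_sym[of "u - v"] form_diff_right)
  then show "u = v"
    using form_nondegenerate[of "u - v"] by simp
qed simp

lemma restrict_h_eqI: "\<sigma> (weight_one u) = weight_one v \<Longrightarrow> restrict_h \<sigma> u = v"
  unfolding restrict_h_def by (auto simp: weight_one_inject)

text \<open>
  Moving \<open>v(n)\<close> to the right onto the vacuum leaves contractions: with the quadratic part for
  \<open>n = 1\<close>, where the orthonormal expansion of \<open>v\<close> appears, and with \<open>h(-2)1\<close> for \<open>n = 2\<close>. The second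
  value is how \<open>h\<close> can be recovered from the conformal vector.
\<close>
lemma mode_conformal_vector:
  assumes "orthonormal_basis B" "n \<ge> 0"
  shows "mode v n (conformal_vector B h) =
    (if n = 1 then weight_one v else if n = 2 then (2 * \<langle>v, h\<rangle>) *\<^sub>C vac else 0)"
proof -
  have quadratic: "mode v n (mode u (-1) (mode u (-1) vac)) =
      (if n = 1 then (2 * \<langle>v, u\<rangle>) *\<^sub>C mode u (-1) vac else 0)" for u
    using assms(2)
    by (subst mode_commute, subst mode_commute)
      (auto simp: mode_vac mode_linear scaleC_add_left[symmetric])
  have linear: "mode v n (mode h (-2) vac) = (if n = 2 then (2 * \<langle>v, h\<rangle>) *\<^sub>C vac else 0)"
    using assms(2) by (subst mode_commute) (auto simp: mode_vac mode_linear)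
  have "weight_one v = weight_one (\<Sum>u\<in>B. \<langle>v, u\<rangle> *\<^sub>C u)"
    by (simp only: orthonormal_basis_expansion(2)[OF assms(1), of v, symmetric])
  then have expand: "(\<Sum>u\<in>B. \<langle>v, u\<rangle> *\<^sub>C mode u (-1) vac) = weight_one v"
    by (simp add: clinear_sum[OF clinear_weight_one] clinear_scale[OF clinear_weight_one])
      (simp add: weight_one_def)
  show ?thesis
    by (auto simp: conformal_vector_def mode_linear quadratic linear complex_vector.scale_sum_right
        scaleC_scaleC expand)
qed

text \<open>The words in negative modes applied to the vacuum; the index is the conformal weight.\<close>

inductive neg_word :: "int \<Rightarrow> 'h::quadratic_space heis \<Rightarrow> bool" where
  vac: "neg_word 0 vac"
| mode: "neg_word w a \<Longrightarrow> n > 0 \<Longrightarrow> neg_word (w + n) (mode u (- n) a)"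

lemma neg_word_low:
  assumes "neg_word w a"
  shows "w \<ge> 0 \<and> (w = 0 \<longrightarrow> a = vac) \<and> (w = 1 \<longrightarrow> a \<in> range weight_one)"
  using assms
proof induction
  case (mode w a n u)
  have "mode u (- n) a \<in> range weight_one" if "w + n = 1"
  proof -
    have "w = 0" "n = 1" using mode that by linarith+
    then show ?thesis using mode by (simp add: weight_one_def)
  qed
  then show ?case using mode by simp
qed simp

definition weight_space :: "int \<Rightarrow> 'h::quadratic_space heis set"
  where "weight_space w = cspan {a. neg_word w a}"

lemma weight_space_neg_mode:
  assumes "a \<in> weight_space w" "n > 0"
  shows "mode u (- n) a \<in> weight_space (w + n)"
  using assms(1) unfolding weight_space_def
proof (induction rule: complex_vector.span_induct_alt)
  case base
  then show ?case by (simp add: mode_linear complex_vector.span_zero)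
next
  case (step c x y)
  then show ?case using neg_word.mode[OF _ assms(2), of w x u]
    by (simp add: mode_linear complex_vector.span_add complex_vector.span_scale complex_vector.span_base)
qed

text \<open>
  A nonnegative mode is commuted to the right until it kills the vacuum; each commutator is a scalar
  and removes a pair of modes of opposite degree, which is compatible with the weight.
\<close>
lemma mode_neg_word:
  assumes "neg_word w a"
  shows "mode u m a \<in> weight_space (w - m)"
  using assms
proof induction
  case vac
  show ?case
  proof (cases "m < 0")
    case True
    then have "neg_word (0 + - m) (mode u (- (- m)) vac)" by (intro neg_word.intros) simp
    then show ?thesis by (simp add: weight_space_def complex_vector.span_base)
  qed (simp add: mode_vac weight_space_def complex_vector.span_zero)
next
  case (mode w a n v)
  have "mode v (- n) (mode u m a) \<in> weight_space (w - m + n)"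
    by (rule weight_space_neg_mode[OF mode.IH mode.hyps(2)])
  moreover have "a \<in> weight_space w"
    using mode.hyps by (simp add: weight_space_def complex_vector.span_base)
  ultimately show ?case
    by (subst mode_commute)
      (auto simp: weight_space_def algebra_simps intro: complex_vector.span_add complex_vector.span_scale)
qed

lemma neg_words_span: "a \<in> cspan {x. \<exists>w. neg_word w x}" (is "_ \<in> cspan ?N")
proof (induction a rule: mode_induct)
  case vac
  show ?case by (rule complex_vector.span_base) (auto intro: neg_word.vac)
next
  case (mode u n a)
  then show ?case
  proof (induction rule: complex_vector.span_induct_alt)
    case base
    then show ?case by (simp add: mode_linear complex_vector.span_zero)
  next
    case (step c x y)
    then obtain w where "neg_word w x" by blast
    then have "mode u n x \<in> cspan {a. neg_word (w - n) a}"
      using mode_neg_word by (simp add: weight_space_def)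
    also have "\<dots> \<subseteq> cspan ?N" by (rule complex_vector.span_mono) blast
    finally show ?case
      using step by (simp add: mode_linear complex_vector.span_add complex_vector.span_scale)
  qed
qed (auto intro: complex_vector.span_zero complex_vector.span_add complex_vector.span_scale)

lemma weight_decomposition:
  "\<exists>F f. finite F \<and> a = sum f F \<and> (\<forall>w. f w \<in> weight_space w)"
  using neg_words_span[of a]
proof (induction rule: complex_vector.span_induct_alt)
  case base
  show ?case by (intro exI[of _ "{}"] exI[of _ "\<lambda>_. 0"]) (simp add: weight_space_def complex_vector.span_zero)
next
  case (step c x y)
  then obtain w F f where w: "neg_word w x" and f: "finite F" "y = sum f F" "\<forall>w. f w \<in> weight_space w"
    by blast
  define f' where "f' v = (if v \<in> F then f v else 0) + (if v = w then c *\<^sub>C x else 0)" for v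
  have "sum f' (insert w F) = c *\<^sub>C x + y"
  proof -
    have "sum f' (insert w F) = (\<Sum>v\<in>insert w F. if v \<in> F then f v else 0)
        + (\<Sum>v\<in>insert w F. if v = w then c *\<^sub>C x else 0)"
      unfolding sum.distrib[symmetric] f'_def ..
    also have "(\<Sum>v\<in>insert w F. if v \<in> F then f v else 0) = sum f F"
      using f(1) by (intro sum.mono_neutral_cong_right) auto
    finally show ?thesis
      using f by (simp only: sum.delta finite_insert insertI1 if_True add.commute)
  qed
  moreover have "f' v \<in> weight_space v" for v
    using f(3) w by (auto simp: f'_def weight_space_def intro: complex_vector.span_add
        complex_vector.span_scale complex_vector.span_base complex_vector.span_zero)
  ultimately show ?case
    using f(1) by (intro exI[of _ "insert w F"] exI[of _ f']) auto
qed

section \<open>Automorphisms fixing the conformal vector\<close>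

locale heisenberg_vertex_algebra =
  fixes Y :: "'h::quadratic_space heis \<Rightarrow> int \<Rightarrow> 'h heis \<Rightarrow> 'h heis"
  assumes vertex_algebra: "vertex_algebra vac Y"
    and Y_generators: "\<And>u n. Y (mode u (-1) vac) n = mode u n"
begin

lemma clinear_Y_left: "clinear (\<lambda>a. Y a n b)"
  and clinear_Y: "clinear (Y a n)"
  and Y_vac_left: "Y vac n b = (if n = -1 then b else 0)"
  and Y_vac_right: "n \<ge> 0 \<Longrightarrow> Y a n vac = 0"
  and borcherds: "Sum_any (\<lambda>i::nat. (of_int m gchoose i) *\<^sub>C Y (Y a (n + int i) b) (m + k - int i) c) =
      Sum_any (\<lambda>i::nat. ((-1) ^ i * (of_int n gchoose i)) *\<^sub>C
        (Y a (m + n - int i) (Y b (k + int i) c)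
          - ((-1) powi n) *\<^sub>C Y b (n + k - int i) (Y a (m + int i) c)))"
  using vertex_algebra unfolding vertex_algebra_def by blast+

lemma Y_weight_one: "Y (weight_one u) n = mode u n"
  by (simp add: weight_one_def Y_generators)

text \<open>
  The two classical special cases of the Borcherds identity: \<open>n = 0\<close> is the commutator formula,
  \<open>m = 0\<close> expresses the modes of a product through those of its factors.
\<close>
lemma commutator_formula:
  "Y a m (Y b k c) - Y b k (Y a m c) =
    Sum_any (\<lambda>i::nat. (of_int m gchoose i) *\<^sub>C Y (Y a (int i) b) (m + k - int i) c)"
proof -
  let ?f = "\<lambda>i::nat. ((-1) ^ i * (of_int 0 gchoose i)) *\<^sub>C
        (Y a (m + 0 - int i) (Y b (k + int i) c)
          - ((-1) powi 0) *\<^sub>C Y b (0 + k - int i) (Y a (m + int i) c))"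
  have "?f i = 0" if "i \<noteq> 0" for i
    using that by (cases i) auto
  then have "{i. ?f i \<noteq> 0} \<subseteq> {0}" by blast
  then have "Sum_any ?f = sum ?f {0}" by (intro Sum_any.expand_superset) auto
  also have "\<dots> = Y a m (Y b k c) - Y b k (Y a m c)" by (simp add: scaleC_one)
  finally show ?thesis using borcherds[of m a 0 b k c] by simp
qed

lemma iterate_formula:
  "Y (Y a n b) k c = Sum_any (\<lambda>i::nat. ((-1) ^ i * (of_int n gchoose i)) *\<^sub>C
        (Y a (n - int i) (Y b (k + int i) c)
          - ((-1) powi n) *\<^sub>C Y b (n + k - int i) (Y a (int i) c)))"
proof -
  let ?f = "\<lambda>i::nat. (of_int 0 gchoose i) *\<^sub>C Y (Y a (n + int i) b) (0 + k - int i) c"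
  have "?f i = 0" if "i \<noteq> 0" for i
    using that by (cases i) auto
  then have "{i. ?f i \<noteq> 0} \<subseteq> {0}" by blast
  then have "Sum_any ?f = sum ?f {0}" by (intro Sum_any.expand_superset) auto
  also have "\<dots> = Y (Y a n b) k c" by (simp add: scaleC_one)
  finally show ?thesis using borcherds[of 0 a n b k c] by simp
qed

text \<open>
  \<open>[L\<^sub>0, v(m)] = -m v(m)\<close>. The commutator is taken with \<open>v\<close> in the first place, so that only the
  products of \<open>v\<close> with the conformal vector occur and no normally ordered product has to be
  expanded. The term from \<open>h(-2)1\<close> carries the binomial coefficient of \<open>m\<close> over \<open>2\<close> and the
  \<open>(m-1)\<close>-st mode of the vacuum; these are nonzero for no common \<open>m\<close>, so \<open>h\<close> does not change \<open>L\<^sub>0\<close>.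
\<close>
lemma conformal_commutator:
  assumes "orthonormal_basis B"
  shows "Y (conformal_vector B h) 1 (mode v m a) =
    mode v m (Y (conformal_vector B h) 1 a) - of_int m *\<^sub>C mode v m a"
proof -
  let ?\<omega> = "conformal_vector B h"
  let ?f = "\<lambda>i::nat. (of_int m gchoose i) *\<^sub>C Y (Y (weight_one v) (int i) ?\<omega>) (m + 1 - int i) a"
  have prod: "Y (weight_one v) (int i) ?\<omega> =
    (if i = 1 then weight_one v else if i = 2 then (2 * \<langle>v, h\<rangle>) *\<^sub>C vac else 0)" for i
    unfolding Y_weight_one by (subst mode_conformal_vector[OF assms]) auto
  have "?f i = 0" if "i \<notin> {1, 2}" for i
    using that unfolding prod by (simp add: clinear_zero[OF clinear_Y_left])
  then have "{i. ?f i \<noteq> 0} \<subseteq> {1, 2}" by blast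
  then have "Sum_any ?f = sum ?f {1, 2}" by (intro Sum_any.expand_superset) auto
  also have "\<dots> = of_int m *\<^sub>C mode v m a + (of_int m gchoose 2) *\<^sub>C (2 * \<langle>v, h\<rangle>) *\<^sub>C Y vac (m - 1) a"
    unfolding prod by (simp add: clinear_scale[OF clinear_Y_left] Y_weight_one)
  also have "(of_int m gchoose 2) *\<^sub>C (2 * \<langle>v, h\<rangle>) *\<^sub>C Y vac (m - 1) a = 0"
    by (simp add: Y_vac_left numeral_2_eq_2)
  finally have "Y (weight_one v) m (Y ?\<omega> 1 a) - Y ?\<omega> 1 (Y (weight_one v) m a) = of_int m *\<^sub>C mode v m a"
    using commutator_formula[of "weight_one v" m ?\<omega> 1 a] by simp
  then show ?thesis by (simp add: Y_weight_one algebra_simps)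
qed

lemma conformal_weight:
  assumes "orthonormal_basis B" "a \<in> weight_space w"
  shows "Y (conformal_vector B h) 1 a = of_int w *\<^sub>C a"
proof -
  have word: "Y (conformal_vector B h) 1 a = of_int w *\<^sub>C a" if "neg_word w a" for w a
    using that
  proof induction
    case vac
    then show ?case by (simp add: Y_vac_right)
  next
    case (mode w a n u)
    then show ?case
      by (simp add: conformal_commutator[OF assms(1)] mode_linear scaleC_add_left)
  qed
  show ?thesis
    by (rule clinear_eq_on_span[OF clinear_Y _ word assms(2)[unfolded weight_space_def]])
      (auto simp: clinear_iff scaleC_add_right scaleC_scaleC mult.commute)
qed

text \<open>
  The operator \<open>(L\<^sub>0 - k) / (1 - k)\<close> fixes the eigenvector and its component of weight \<open>1\<close>, rescales
  the other components and kills that of weight \<open>k\<close>; so the other weights can be removed one at a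
  time. A word of weight \<open>1\<close> has a single letter of degree \<open>-1\<close>.
\<close>
lemma eigenvector_weight_one:
  assumes B: "orthonormal_basis B" and a: "Y (conformal_vector B h) 1 a = a"
  shows "a \<in> range weight_one"
proof -
  let ?L = "Y (conformal_vector B h) 1"
  have elim: "a \<in> weight_space 1"
    if "finite F" "1 \<notin> F" "b \<in> weight_space 1" "a = b + sum f F" "\<And>w. f w \<in> weight_space w" for F b f
    using that
  proof (induction F arbitrary: f rule: finite_induct)
    case empty
    then show ?case by simp
  next
    case (insert k F)
    define f' where "f' w = ((of_int w - of_int k) / (1 - of_int k)) *\<^sub>C f w" for w
    have k: "(1 - of_int k :: complex) \<noteq> 0" using insert.prems(1) by (metis eq_iff_diff_eq_0 insertI1 of_int_1 of_int_eq_iff)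
    have "?L a - of_int k *\<^sub>C a = (1 - of_int k) *\<^sub>C b + (\<Sum>w\<in>insert k F. (of_int w - of_int k) *\<^sub>C f w)"
      by (simp add: insert.prems(3) clinear_add[OF clinear_Y] clinear_sum[OF clinear_Y]
          conformal_weight[OF B insert.prems(2)] conformal_weight[OF B insert.prems(4)]
          complex_vector.scale_left_diff_distrib sum_subtractf complex_vector.scale_sum_right
          scaleC_add_right scaleC_one del: sum.insert)
    also have "\<dots> = (1 - of_int k) *\<^sub>C b + (\<Sum>w\<in>F. (of_int w - of_int k) *\<^sub>C f w)"
      using insert.hyps by simp
    finally have "(1 / (1 - of_int k)) *\<^sub>C ((1 - of_int k) *\<^sub>C a) =
       (1 / (1 - of_int k)) *\<^sub>C ((1 - of_int k) *\<^sub>C b + (\<Sum>w\<in>F. (of_int w - of_int k) *\<^sub>C f w))"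
      by (simp add: a complex_vector.scale_left_diff_distrib scaleC_one)
    then have "a = b + sum f' F"
      using k by (simp add: f'_def scaleC_scaleC scaleC_one scaleC_add_right complex_vector.scale_sum_right)
    then show ?case
      using insert.prems by (intro insert.IH[of f'])
        (auto simp: f'_def weight_space_def intro: complex_vector.span_scale)
  qed
  obtain F f where f: "finite F" "a = sum f F" "\<And>w. f w \<in> weight_space w"
    using weight_decomposition[of a] by blast
  have "a \<in> weight_space 1"
  proof (cases "1 \<in> F")
    case True
    then show ?thesis
      using elim[of "F - {1}" "f 1" f] f by (simp add: sum.remove)
  next
    case False
    then show ?thesis
      using elim[of F 0 f] f by (simp add: weight_space_def complex_vector.span_zero)
  qed
  moreover have "csubspace (range weight_one)"
    by (rule complex_vector.subspaceI)
      (auto simp flip: clinear_add[OF clinear_weight_one] clinear_scale[OF clinear_weight_one]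
        clinear_zero[OF clinear_weight_one])
  then have "weight_space 1 \<subseteq> range weight_one"
    unfolding weight_space_def using neg_word_low by (intro complex_vector.span_minimal) auto
  ultimately show ?thesis by blast
qed

lemma conformal_weight_one:
  assumes "orthonormal_basis B"
  shows "Y (conformal_vector B h) 1 (weight_one u) = weight_one u"
  using conformal_commutator[OF assms, of h u "-1" vac]
  by (simp add: weight_one_def Y_vac_right mode_linear scaleC_one)

text \<open>
  An automorphism that fixes the conformal vector commutes with \<open>L\<^sub>0\<close>, hence preserves its eigenspace
  \<open>\<h>\<close>; it preserves \<open>u(1) v(-1) 1\<close>, hence the form, and \<open>v(2) \<omega>\<close>, hence the pairing with \<open>h\<close>.
\<close>
lemma conformal_aut_restrict:
  assumes B: "orthonormal_basis B" and \<sigma>: "\<sigma> \<in> conformal_aut Y (conformal_vector B h)"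
  shows "form_isometry (restrict_h \<sigma>)" "restrict_h \<sigma> h = h"
proof -
  let ?\<omega> = "conformal_vector B h" and ?g = "restrict_h \<sigma>"
  have lin: "clinear \<sigma>" and bij: "bij \<sigma>" and vac: "\<sigma> vac = vac"
    and hom: "\<And>a n b. \<sigma> (Y a n b) = Y (\<sigma> a) n (\<sigma> b)" and \<omega>: "\<sigma> ?\<omega> = ?\<omega>"
    using \<sigma> by (auto simp: conformal_aut_def vertex_automorphism_def)
  have g: "weight_one (?g u) = \<sigma> (weight_one u)" for u
  proof -
    have "\<sigma> (weight_one u) \<in> range weight_one"
      using hom[of ?\<omega> 1 "weight_one u"]
      by (intro eigenvector_weight_one[OF B, of h]) (simp add: \<omega> conformal_weight_one[OF B])
    then obtain v where "\<sigma> (weight_one u) = weight_one v" by blast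
    then show ?thesis using restrict_h_eqI by metis
  qed
  have mode: "\<sigma> (mode u n a) = mode (?g u) n (\<sigma> a)" for u n a
    using hom[of "weight_one u" n a] by (simp add: Y_weight_one flip: g)
  have scale_vac: "c = d" if "c *\<^sub>C vac = d *\<^sub>C (vac :: 'h heis)" for c d
    using that vac_nonzero[where 'h = 'h] by simp
  have form: "\<langle>?g u, ?g v\<rangle> = \<langle>u, v\<rangle>" for u v
    using mode[of u 1 "weight_one v"]
    by (intro scale_vac) (simp only: mode_one_weight_one clinear_scale[OF lin] vac flip: g)
  have lin_g: "clinear ?g"
    unfolding clinear_iff
  proof (intro conjI allI)
    fix x y
    have "weight_one (?g (x + y)) = weight_one (?g x + ?g y)"
      by (simp add: g clinear_add[OF clinear_weight_one] clinear_add[OF lin])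
    then show "?g (x + y) = ?g x + ?g y" by (simp add: weight_one_inject)
  next
    fix c x
    have "weight_one (?g (c *\<^sub>C x)) = weight_one (c *\<^sub>C ?g x)"
      by (simp add: g clinear_scale[OF clinear_weight_one] clinear_scale[OF lin])
    then show "?g (c *\<^sub>C x) = c *\<^sub>C ?g x" by (simp add: weight_one_inject)
  qed
  \<comment> \<open>The preimage of a vector in \<open>\<h>\<close> is again an eigenvector of \<open>L\<^sub>0\<close>.\<close>
  have surj_g: "\<exists>v. ?g v = u" for u
  proof -
    obtain a where a: "\<sigma> a = weight_one u"
      using bij by (metis bij_is_surj surjD)
    have "\<sigma> (Y ?\<omega> 1 a) = \<sigma> a"
      by (simp add: hom \<omega> a conformal_weight_one[OF B])
    then have "Y ?\<omega> 1 a = a"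
      using bij by (meson bij_is_inj injD)
    then obtain v where "a = weight_one v"
      using eigenvector_weight_one[OF B] by blast
    then show ?thesis using a g weight_one_inject by metis
  qed
  have inj_g: "inj ?g"
    by (rule injI) (metis g weight_one_inject bij bij_is_inj injD)
  show "form_isometry ?g"
    using form lin_g inj_g surj_g by (simp add: form_isometry_def bij_def surj_def) metis
  \<comment> \<open>Both sides are read off from the image of \<open>v(2) \<omega>\<close>.\<close>
  have *: "\<langle>?g v, h\<rangle> = \<langle>?g v, ?g h\<rangle>" for v
  proof -
    have "\<sigma> (mode v 2 ?\<omega>) = mode (?g v) 2 ?\<omega>" by (simp add: mode \<omega>)
    then have "2 * \<langle>v, h\<rangle> = 2 * \<langle>?g v, h\<rangle>"
      by (intro scale_vac) (simp add: mode_conformal_vector[OF B] clinear_scale[OF lin] vac)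
    then show ?thesis by (simp add: form)
  qed
  have "\<langle>?g h - h, x\<rangle> = 0" for x
    using surj_g[of x] * by (auto simp: form_sym[of "?g h - h"] form_diff_right)
  then show "?g h = h"
    using form_nondegenerate[of "?g h - h"] by simp
qed

end

text \<open>Injectivity keeps the set of nonzero terms, on which \<^const>\<open>Sum_any\<close> depends.\<close>
lemma clinear_Sum_any:
  assumes "clinear f" "inj f"
  shows "f (Sum_any g) = Sum_any (\<lambda>i. f (g i))"
proof -
  have "f x = 0 \<longleftrightarrow> x = 0" for x
    using assms by (metis clinear_zero injD)
  then show ?thesis
    by (simp add: Sum_any.expand_set clinear_sum[OF assms(1)])
qed

definition affine_map :: "('h \<Rightarrow> 'h) \<Rightarrow> 'h::quadratic_space affine \<Rightarrow> 'h affine"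
  where "affine_map g x = (Poly_Mapping.map g (fst x), snd x)"

lemma lookup_map:
  "g 0 = 0 \<Longrightarrow> Poly_Mapping.lookup (Poly_Mapping.map g f) n = g (Poly_Mapping.lookup f n)"
  by (simp add: map.rep_eq when_def)

text \<open>An isometry acts on the affine Lie algebra, and the vacuum of the twisted module satisfies the
  defining relations of the vacuum.\<close>
lemma isometry_lift:
  fixes g :: "'h::quadratic_space \<Rightarrow> 'h"
  assumes "form_isometry g"
  obtains \<Phi> where "clinear \<Phi>" "\<Phi> vac = vac" "\<And>u n a. \<Phi> (mode u n a) = mode (g u) n (\<Phi> a)"
proof -
  have lin: "clinear g" and inj: "inj g" and form: "\<And>x y. \<langle>g x, g y\<rangle> = \<langle>x, y\<rangle>"
    using assms by (auto simp: form_isometry_def bij_is_inj)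
  have g0: "g x = 0 \<longleftrightarrow> x = 0" for x
    using inj by (metis clinear_zero[OF lin] injD)
  note look = lookup_map[of g, OF clinear_zero[OF lin]]
  have add: "affine_map g (x + y) = affine_map g x + affine_map g y" for x y
    by (auto simp: affine_map_def prod_eq_iff poly_mapping_eq_iff fun_eq_iff look lookup_add clinear_add[OF lin])
  have scale: "affine_map g (c *\<^sub>C x) = c *\<^sub>C affine_map g x" for c x
    by (auto simp: affine_map_def scaleC_prod_def poly_mapping_eq_iff fun_eq_iff look lookup_scaleC
        clinear_scale[OF lin])
  have keys: "Poly_Mapping.keys (Poly_Mapping.map g f) = Poly_Mapping.keys f" for f :: "int \<Rightarrow>\<^sub>0 'h"
    by (auto simp: in_keys_iff look g0)
  have bracket: "affine_bracket (affine_map g x) (affine_map g y) = affine_map g (affine_bracket x y)" for x y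
    by (simp add: affine_bracket_def affine_map_def keys look form map_eq_zero_iff)
  have elem: "affine_map g (affine_elem u n) = affine_elem (g u) n" for u n
    by (auto simp: affine_map_def affine_elem_def poly_mapping_eq_iff fun_eq_iff look lookup_single when_def
        clinear_zero[OF lin])
  show ?thesis
  proof (rule induced_module_hom[where \<rho> = "\<lambda>x. affine_act (affine_map g x)" and M = UNIV and ?v0.0 = vac])
    show "affine_act (affine_map g x) vac = snd x *\<^sub>C vac" if "x \<in> affine_nonneg" for x
      using that by (subst affine_act_vac) (auto simp: affine_nonneg_def affine_map_def look clinear_zero[OF lin])
    fix \<Phi> :: "'h heis \<Rightarrow> 'h heis"
    assume "clinear \<Phi>" "\<Phi> vac = vac" "\<And>x a. \<Phi> (affine_act x a) = affine_act (affine_map g x) (\<Phi> a)"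
    then show ?thesis
      by (intro that[of \<Phi>]) (simp_all add: mode_def elem)
  qed (simp_all add: clinear_affine_act add scale affine_act_add affine_act_scale affine_act_bracket bracket)
qed

text \<open>
  The image of an orthonormal basis is orthonormal, and the quadratic part of the conformal vector is
  the same for all orthonormal bases.
\<close>
lemma conformal_vector_isometry:
  assumes B: "orthonormal_basis B" and g: "form_isometry g" "g h = h"
    and \<Phi>: "clinear \<Phi>" "\<Phi> vac = vac" "\<And>u n a. \<Phi> (mode u n a) = mode (g u) n (\<Phi> a)"
  shows "\<Phi> (conformal_vector B h) = conformal_vector B h"
proof -
  note exp = orthonormal_basis_expansion[OF B]
  have on: "\<langle>u, v\<rangle> = (if u = v then 1 else 0)" if "u \<in> B" "v \<in> B" for u v
    using B that by (simp add: orthonormal_basis_def)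
  have gram: "(\<Sum>u\<in>B. \<langle>g u, x\<rangle> * \<langle>g u, y\<rangle>) = \<langle>x, y\<rangle>" for x y
  proof -
    obtain x' y' where "x = g x'" "y = g y'"
      using g(1) by (metis form_isometry_def bij_is_surj surjD)
    then show ?thesis
      using g(1) exp(3)[of x' y'] by (simp add: form_isometry_def form_sym)
  qed
  let ?M = "\<lambda>u v. mode u (-1) (mode v (-1) vac)"
  have expand: "?M x x = (\<Sum>v\<in>B. \<Sum>w\<in>B. (\<langle>x, v\<rangle> * \<langle>x, w\<rangle>) *\<^sub>C ?M v w)" for x
  proof -
    have "?M x x = ?M (\<Sum>v\<in>B. \<langle>x, v\<rangle> *\<^sub>C v) (\<Sum>w\<in>B. \<langle>x, w\<rangle> *\<^sub>C w)"
      by (simp only: exp(2)[of x, symmetric])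
    also have "\<dots> = (\<Sum>v\<in>B. \<Sum>w\<in>B. (\<langle>x, v\<rangle> * \<langle>x, w\<rangle>) *\<^sub>C ?M v w)"
      by (subst sum.swap)
        (simp add: mode_linear complex_vector.scale_sum_right scaleC_scaleC mult.commute)
    finally show ?thesis .
  qed
  have "(\<Sum>u\<in>B. ?M (g u) (g u)) = (\<Sum>u\<in>B. \<Sum>v\<in>B. \<Sum>w\<in>B. (\<langle>g u, v\<rangle> * \<langle>g u, w\<rangle>) *\<^sub>C ?M v w)"
    by (rule sum.cong[OF refl]) (rule expand)
  also have "\<dots> = (\<Sum>v\<in>B. \<Sum>w\<in>B. \<Sum>u\<in>B. (\<langle>g u, v\<rangle> * \<langle>g u, w\<rangle>) *\<^sub>C ?M v w)"
    by (subst sum.swap) (intro sum.cong refl sum.swap)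
  also have "\<dots> = (\<Sum>v\<in>B. \<Sum>w\<in>B. \<langle>v, w\<rangle> *\<^sub>C ?M v w)"
    by (simp add: gram flip: complex_vector.scale_sum_left)
  also have "\<dots> = (\<Sum>v\<in>B. \<Sum>w\<in>B. if v = w then ?M v w else 0)"
    by (intro sum.cong refl) (simp add: on scaleC_one)
  also have "\<dots> = (\<Sum>v\<in>B. ?M v v)"
    using exp(1) by simp
  finally show ?thesis
    by (simp add: conformal_vector_def clinear_add[OF \<Phi>(1)] clinear_scale[OF \<Phi>(1)] clinear_sum[OF \<Phi>(1)] \<Phi> g)
qed

context heisenberg_vertex_algebra begin

text \<open>
  The lift of an isometry commutes with the modes by construction. That it respects all products
  follows by induction on the left factor: the iterate formula writes the products by \<open>u(k) a\<close>
  through the modes of \<open>u\<close> and the products by \<open>a\<close>.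
\<close>
lemma conformal_aut_lift:
  assumes B: "orthonormal_basis B" and g: "form_isometry g" "g h = h"
  obtains \<sigma> where "\<sigma> \<in> conformal_aut Y (conformal_vector B h)" "restrict_h \<sigma> = g"
proof -
  obtain \<sigma> where \<sigma>: "clinear \<sigma>" "\<sigma> vac = vac" "\<And>u n a. \<sigma> (mode u n a) = mode (g u) n (\<sigma> a)"
    using isometry_lift[OF g(1)] by blast
  obtain \<tau> where \<tau>: "clinear \<tau>" "\<tau> vac = vac" "\<And>u n a. \<tau> (mode u n a) = mode (inv g u) n (\<tau> a)"
    using isometry_lift[OF form_isometry_inv[OF g(1)]] by blast
  have inv: "inv g (g u) = u" "g (inv g u) = u" for u
    using g(1) by (simp_all add: form_isometry_def bij_is_inj bij_is_surj surj_f_inv_f inv_f_f)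
  have "\<tau> (\<sigma> a) = a" for a
    by (induction a rule: mode_induct)
      (simp_all add: \<sigma> \<tau> inv clinear_zero[OF \<sigma>(1)] clinear_zero[OF \<tau>(1)] clinear_add[OF \<sigma>(1)]
        clinear_add[OF \<tau>(1)] clinear_scale[OF \<sigma>(1)] clinear_scale[OF \<tau>(1)])
  moreover have "\<sigma> (\<tau> a) = a" for a
    by (induction a rule: mode_induct)
      (simp_all add: \<sigma> \<tau> inv clinear_zero[OF \<sigma>(1)] clinear_zero[OF \<tau>(1)] clinear_add[OF \<sigma>(1)]
        clinear_add[OF \<tau>(1)] clinear_scale[OF \<sigma>(1)] clinear_scale[OF \<tau>(1)])
  ultimately have bij: "bij \<sigma>" by (metis bijI')
  have hom: "\<sigma> (Y a n b) = Y (\<sigma> a) n (\<sigma> b)" for a n b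
  proof (induction a arbitrary: n b rule: mode_induct)
    case zero
    then show ?case by (simp add: clinear_zero[OF \<sigma>(1)] clinear_zero[OF clinear_Y_left])
  next
    case (add a b)
    then show ?case by (simp add: clinear_add[OF \<sigma>(1)] clinear_add[OF clinear_Y_left])
  next
    case (scale c a)
    then show ?case by (simp add: clinear_scale[OF \<sigma>(1)] clinear_scale[OF clinear_Y_left])
  next
    case vac
    then show ?case by (simp add: \<sigma> Y_vac_left clinear_zero[OF \<sigma>(1)])
  next
    case (mode u k a)
    have "\<sigma> (Y (mode u k a) n b) = \<sigma> (Y (Y (weight_one u) k a) n b)"
      by (simp add: Y_weight_one)
    also have "\<dots> = Y (Y (weight_one (g u)) k (\<sigma> a)) n (\<sigma> b)"
      unfolding iterate_formula
      by (simp add: clinear_Sum_any[OF \<sigma>(1) bij_is_inj[OF bij]] clinear_scale[OF \<sigma>(1)]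
          clinear_diff[OF \<sigma>(1)] Y_weight_one \<sigma>(3) mode)
    finally show ?case by (simp add: Y_weight_one \<sigma>(3))
  qed
  have "restrict_h \<sigma> u = g u" for u
    by (rule restrict_h_eqI) (simp add: weight_one_def \<sigma>)
  then have "restrict_h \<sigma> = g" ..
  moreover have "\<sigma> \<in> conformal_aut Y (conformal_vector B h)"
    using \<sigma> bij hom conformal_vector_isometry[OF B g \<sigma>]
    by (simp add: conformal_aut_def vertex_automorphism_def)
  ultimately show ?thesis using that by blast
qed

lemma restrict_h_conformal_aut:
  assumes "orthonormal_basis B"
  shows "restrict_h ` conformal_aut Y (conformal_vector B h) = {g. form_isometry g \<and> g h = h}"
proof (intro equalityI subsetI)
  fix g assume "g \<in> {g. form_isometry g \<and> g h = h}"
  then obtain \<sigma> where "\<sigma> \<in> conformal_aut Y (conformal_vector B h)" "restrict_h \<sigma> = g"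
    using conformal_aut_lift[OF assms] by blast
  then show "g \<in> restrict_h ` conformal_aut Y (conformal_vector B h)" by blast
qed (use conformal_aut_restrict[OF assms] in auto)

end

section \<open>Orthonormal frames of regular subspaces\<close>

text \<open>
  Frames are indexed by initial segments of \<open>\<nat>\<close>, so that a frame of a subspace and one of its
  orthogonal complement can be concatenated; that a frame spans is expressed by the orthonormal
  expansion.
\<close>

definition orthonormal_family :: "(nat \<Rightarrow> 'h::quadratic_space) \<Rightarrow> nat \<Rightarrow> bool"
  where "orthonormal_family e n \<longleftrightarrow> (\<forall>i<n. \<forall>j<n. \<langle>e i, e j\<rangle> = (if i = j then 1 else 0))"

definition frame :: "(nat \<Rightarrow> 'h::quadratic_space) \<Rightarrow> nat \<Rightarrow> 'h set \<Rightarrow> bool"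
  where "frame e n S \<longleftrightarrow> orthonormal_family e n \<and> (\<forall>i<n. e i \<in> S) \<and>
    (\<forall>x\<in>S. x = (\<Sum>i<n. \<langle>x, e i\<rangle> *\<^sub>C e i))"

lemma orthonormal_family_coefficient:
  assumes "orthonormal_family e n" "j < n"
  shows "\<langle>\<Sum>i<n. c i *\<^sub>C e i, e j\<rangle> = c j"
proof -
  have "\<langle>\<Sum>i<n. c i *\<^sub>C e i, e j\<rangle> = (\<Sum>i<n. if i = j then c i else 0)"
    unfolding form_sum_left
    using assms by (intro sum.cong) (auto simp: form_scale_left orthonormal_family_def)
  then show ?thesis using assms(2) by simp
qed

lemma orthonormal_family_inj: "orthonormal_family e n \<Longrightarrow> inj_on e {..<n}"
  unfolding orthonormal_family_def inj_on_def by (metis lessThan_iff zero_neq_one)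

lemma orthonormal_family_independent:
  assumes "orthonormal_family e n"
  shows "cindependent (e ` {..<n})"
proof (rule complex_vector.independent_if_scalars_zero)
  fix f x
  assume sum: "(\<Sum>x\<in>e ` {..<n}. f x *\<^sub>C x) = 0" and "x \<in> e ` {..<n}"
  then obtain j where j: "j < n" "x = e j" by auto
  have "(\<Sum>i<n. f (e i) *\<^sub>C e i) = 0"
    using sum by (simp add: sum.reindex[OF orthonormal_family_inj[OF assms]])
  then show "f x = 0"
    using orthonormal_family_coefficient[OF assms j(1), of "\<lambda>i. f (e i)"] j(2) by simp
qed simp

lemma orthonormal_family_card: "orthonormal_family e n \<Longrightarrow> card (e ` {..<n}) = n"
  by (simp add: card_image orthonormal_family_inj)

lemma frame_family: "frame e n S \<Longrightarrow> orthonormal_family e n"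
  and frame_mem: "frame e n S \<Longrightarrow> i < n \<Longrightarrow> e i \<in> S"
  and frame_expansion: "frame e n S \<Longrightarrow> x \<in> S \<Longrightarrow> (\<Sum>i<n. \<langle>x, e i\<rangle> *\<^sub>C e i) = x"
  and frame_form: "frame e n S \<Longrightarrow> i < n \<Longrightarrow> j < n \<Longrightarrow> \<langle>e i, e j\<rangle> = (if i = j then 1 else 0)"
  unfolding frame_def orthonormal_family_def by metis+

lemma frame_span:
  assumes "frame e n S"
  shows "S \<subseteq> cspan (e ` {..<n})"
proof
  fix x assume "x \<in> S"
  then have "x = (\<Sum>i<n. \<langle>x, e i\<rangle> *\<^sub>C e i)"
    using frame_expansion[OF assms] by simp
  also have "\<dots> \<in> cspan (e ` {..<n})"
    by (intro complex_vector.span_sum complex_vector.span_scale complex_vector.span_base) auto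
  finally show "x \<in> cspan (e ` {..<n})" .
qed

lemma frame_dim: "frame e n S \<Longrightarrow> cdim S = n"
  by (rule complex_vector.dim_unique[of "e ` {..<n}"])
    (auto simp: frame_span orthonormal_family_independent orthonormal_family_card frame_family frame_mem)

lemma frame_of_span:
  assumes "orthonormal_family e n"
  shows "frame e n (cspan (e ` {..<n}))"
proof -
  have "\<langle>u, v\<rangle> = (if u = v then 1 else 0)" if "u \<in> e ` {..<n}" "v \<in> e ` {..<n}" for u v
    using that assms orthonormal_family_inj[OF assms]
    by (auto simp: orthonormal_family_def dest: inj_onD)
  then have "x = (\<Sum>b\<in>e ` {..<n}. \<langle>x, b\<rangle> *\<^sub>C b)" if "x \<in> cspan (e ` {..<n})" for x
    using that by (intro orthonormal_expansion) auto
  then show ?thesis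
    using assms unfolding frame_def sum.reindex[OF orthonormal_family_inj[OF assms]] o_def
    by (blast intro: complex_vector.span_base)
qed

lemma regular_subspaceD: "regular_subspace S \<Longrightarrow> u \<in> S \<Longrightarrow> \<forall>v\<in>S. \<langle>u, v\<rangle> = 0 \<Longrightarrow> u = 0"
  unfolding regular_subspace_def by blast

lemma frame_regular:
  assumes "csubspace S" "frame e n S"
  shows "regular_subspace S"
  unfolding regular_subspace_def
proof (intro conjI ballI impI)
  fix u assume u: "u \<in> S" "\<forall>v\<in>S. \<langle>u, v\<rangle> = 0"
  then have "u = (\<Sum>i<n. \<langle>u, e i\<rangle> *\<^sub>C e i)" using frame_expansion[OF assms(2)] by simp
  also have "\<dots> = 0" using u frame_mem[OF assms(2)] by (intro sum.neutral) simp
  finally show "u = 0" .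
qed fact

lemma unit_multiple:
  assumes "\<langle>x, x\<rangle> \<noteq> 0"
  defines "v \<equiv> (1 / csqrt \<langle>x, x\<rangle>) *\<^sub>C x"
  shows "\<langle>v, v\<rangle> = 1" "csqrt \<langle>x, x\<rangle> *\<^sub>C v = x"
proof -
  have "csqrt \<langle>x, x\<rangle> * csqrt \<langle>x, x\<rangle> = \<langle>x, x\<rangle>"
    by (metis power2_csqrt power2_eq_square)
  then show "\<langle>v, v\<rangle> = 1" using assms(1) by (simp add: v_def form_scale_left form_scale_right)
  show "csqrt \<langle>x, x\<rangle> *\<^sub>C v = x" using assms(1) by (simp add: v_def scaleC_scaleC scaleC_one)
qed

text \<open>
  The residue \<open>r\<close> after subtracting the components along the family is nonzero somewhere on \<open>S\<close>. If a
  residue is isotropic, regularity gives a second one that pairs with it, and one of the two or their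
  sum is anisotropic and can be normalised.
\<close>
lemma orthonormal_family_extend:
  assumes S: "regular_subspace S" and e: "orthonormal_family e n" "\<And>i. i < n \<Longrightarrow> e i \<in> S"
    and not_frame: "\<not> frame e n S"
  obtains v where "v \<in> S" "orthonormal_family (e(n := v)) (Suc n)"
proof -
  define r where "r x = x - (\<Sum>i<n. \<langle>x, e i\<rangle> *\<^sub>C e i)" for x
  have sub: "csubspace S" using S by (simp add: regular_subspace_def)
  have r_S: "r x \<in> S" if "x \<in> S" for x
    unfolding r_def using that e(2)
    by (intro complex_vector.subspace_diff[OF sub] complex_vector.subspace_sum[OF sub]
        complex_vector.subspace_scale[OF sub]) auto
  have r_e: "\<langle>r x, e i\<rangle> = 0" if "i < n" for x i
    using orthonormal_family_coefficient[OF e(1) that] by (simp add: r_def form_diff_left)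
  obtain x where x: "x \<in> S" "r x \<noteq> 0"
  proof -
    obtain x where "x \<in> S" "x \<noteq> (\<Sum>i<n. \<langle>x, e i\<rangle> *\<^sub>C e i)"
      using not_frame e unfolding frame_def by blast
    then show ?thesis using that unfolding r_def by (metis right_minus_eq)
  qed
  obtain z where z: "z \<in> S" "\<langle>r x, z\<rangle> \<noteq> 0"
    using S r_S[OF x(1)] x(2) by (auto simp: regular_subspace_def)
  have "\<langle>r x, r z\<rangle> = \<langle>r x, z\<rangle>"
    by (simp add: r_def[of z] form_diff_right form_sum_right form_scale_right r_e)
  then have rxz: "\<langle>r x, r z\<rangle> \<noteq> 0" using z by simp
  obtain u where u: "u \<in> S" "\<langle>u, u\<rangle> \<noteq> 0" "\<And>i. i < n \<Longrightarrow> \<langle>u, e i\<rangle> = 0"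
  proof (cases "\<langle>r x, r x\<rangle> = 0 \<and> \<langle>r z, r z\<rangle> = 0")
    case True
    then have "\<langle>r x + r z, r x + r z\<rangle> = 2 * \<langle>r x, r z\<rangle>"
      by (simp add: form_add_left form_add_right form_sym[of "r z" "r x"])
    then show ?thesis
      using rxz x z r_e r_S by (intro that[of "r x + r z"])
        (auto simp: form_add_left intro: complex_vector.subspace_add[OF sub])
  next
    case False
    then show ?thesis using that[of "r x"] that[of "r z"] r_e r_S[OF x(1)] r_S[OF z(1)] by metis
  qed
  define v where "v = (1 / csqrt \<langle>u, u\<rangle>) *\<^sub>C u"
  have "\<langle>v, v\<rangle> = 1" using unit_multiple[OF u(2)] by (simp add: v_def)
  moreover have "\<langle>v, e i\<rangle> = 0" "\<langle>e i, v\<rangle> = 0" if "i < n" for i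
    using u(3)[OF that] by (simp_all add: v_def form_scale_left form_sym[of "e i"])
  ultimately have "orthonormal_family (e(n := v)) (Suc n)"
    using e(1) by (auto simp: orthonormal_family_def less_Suc_eq)
  moreover have "v \<in> S" unfolding v_def by (rule complex_vector.subspace_scale[OF sub u(1)])
  ultimately show ?thesis using that by blast
qed

lemma orthonormal_family_complete:
  assumes S: "regular_subspace S" and e: "orthonormal_family e m" "\<And>i. i < m \<Longrightarrow> e i \<in> S"
  obtains e' n where "m \<le> n" "\<forall>i<m. e' i = e i" "frame e' n S"
proof -
  obtain T :: "'a set" where T: "finite T" "\<And>x. \<exists>c. x = (\<Sum>b\<in>T. c b *\<^sub>C b)"
    using finite_dimensional by blast
  have T_span: "x \<in> cspan T" for x
    using T(2)[of x] by (auto intro: complex_vector.span_sum complex_vector.span_scale complex_vector.span_base)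
  have bound: "k \<le> card T" if "orthonormal_family f k" for f :: "nat \<Rightarrow> 'a" and k
    using complex_vector.independent_span_bound[OF T(1) orthonormal_family_independent[OF that]]
      orthonormal_family_card[OF that] T_span by auto
  have "\<exists>e' n. m \<le> n \<and> (\<forall>i<m. e' i = e i) \<and> frame e' n S"
    using e
  proof (induction "card T - m" arbitrary: e m rule: less_induct)
    case less
    show ?case
    proof (cases "frame e m S")
      case False
      obtain v where v: "v \<in> S" "orthonormal_family (e(m := v)) (Suc m)"
        using orthonormal_family_extend[OF S less.prems False] by blast
      moreover have "(e(m := v)) i \<in> S" if "i < Suc m" for i
        using less.prems(2) v(1) that by (auto simp: less_Suc_eq)
      ultimately have "\<exists>e' n. Suc m \<le> n \<and> (\<forall>i<Suc m. e' i = (e(m := v)) i) \<and> frame e' n S"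
        using bound[OF v(2)] by (intro less.hyps) (simp_all del: fun_upd_apply)
      then show ?thesis by (auto simp: less_Suc_eq) (metis Suc_leD fun_upd_other less_irrefl)
    qed blast
  qed
  then show ?thesis using that by blast
qed

text \<open>
  The normal form of a vector with \<open>\<langle>x, x\<rangle> = y\<close> in a suitable orthonormal frame: a multiple of the
  first basis vector if \<open>y \<noteq> 0\<close>, and \<open>e\<^sub>0 + \<i> e\<^sub>1\<close> if \<open>x\<close> is isotropic and nonzero. The flag \<open>z\<close> says
  that \<open>x = 0\<close>.
\<close>

definition canonical_vector :: "complex \<Rightarrow> bool \<Rightarrow> (nat \<Rightarrow> 'h::quadratic_space) \<Rightarrow> 'h"
  where "canonical_vector y z e =
    (if z then 0 else if y \<noteq> 0 then csqrt y *\<^sub>C e 0 else e 0 + \<i> *\<^sub>C e 1)"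

text \<open>The pairs of a norm and a zero flag that occur for the vectors of an \<open>n\<close>-dimensional space.\<close>

definition admissible :: "complex \<Rightarrow> bool \<Rightarrow> nat \<Rightarrow> bool"
  where "admissible y z n \<longleftrightarrow> (if z then y = 0 else if y \<noteq> 0 then 1 \<le> n else 2 \<le> n)"

lemma canonical_vector_image:
  "clinear g \<Longrightarrow> g (canonical_vector y z e) = canonical_vector y z (\<lambda>i. g (e i))"
  by (simp add: canonical_vector_def clinear_zero clinear_add clinear_scale)

lemma canonical_vector_cong:
  assumes "admissible y z n" "\<And>i. i < n \<Longrightarrow> e i = e' i"
  shows "canonical_vector y z e = canonical_vector y z e'"
  using assms by (auto simp: canonical_vector_def admissible_def split: if_splits)

lemma canonical_vector_in_span:
  assumes "admissible y z n"
  shows "canonical_vector y z e \<in> cspan (e ` {..<n})"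
proof -
  have "e i \<in> cspan (e ` {..<n})" if "i < n" for i
    using that by (intro complex_vector.span_base) auto
  then show ?thesis
    using assms by (auto simp: canonical_vector_def admissible_def split: if_splits
      intro!: complex_vector.span_add complex_vector.span_scale complex_vector.span_zero)
qed

lemma canonical_vector_norm:
  assumes "admissible y z n" "orthonormal_family e n"
  shows "\<langle>canonical_vector y z e, canonical_vector y z e\<rangle> = y"
proof -
  consider "z" "y = 0" | "\<not> z" "y \<noteq> 0" "1 \<le> n" | "\<not> z" "y = 0" "2 \<le> n"
    using assms(1) by (auto simp: admissible_def split: if_splits)
  then show ?thesis
  proof cases
    case 1
    then show ?thesis by (simp add: canonical_vector_def)
  next
    case 2
    have "csqrt y * (csqrt y * 1) = y" by (metis power2_csqrt power2_eq_square mult_1_right)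
    moreover have "\<langle>e 0, e 0\<rangle> = 1" using assms(2) 2 by (simp add: orthonormal_family_def)
    ultimately show ?thesis
      using 2 by (simp only: canonical_vector_def form_scale_left form_scale_right if_False if_True
          not_False_eq_True)
  next
    case 3
    then have "\<langle>e 0, e 0\<rangle> = 1" "\<langle>e 1, e 1\<rangle> = 1" "\<langle>e 0, e 1\<rangle> = 0" "\<langle>e 1, e 0\<rangle> = 0"
      using assms(2) by (simp_all add: orthonormal_family_def)
    then show ?thesis
      using 3 by (simp add: canonical_vector_def form_add_left form_add_right form_scale_left
          form_scale_right)
  qed
qed

lemma canonical_vector_eq_0:
  assumes "admissible y z n" "orthonormal_family e n"
  shows "canonical_vector y z e = 0 \<longleftrightarrow> z"
proof
  assume 0: "canonical_vector y z e = 0"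
  show z
  proof (rule ccontr)
    assume "\<not> z"
    moreover have "y = 0" using canonical_vector_norm[OF assms] 0 by simp
    ultimately have "\<langle>canonical_vector y z e, e 0\<rangle> = 1"
      using assms by (simp add: canonical_vector_def admissible_def orthonormal_family_def
          form_add_left form_scale_left)
    then show False by (simp add: 0)
  qed
qed (simp add: canonical_vector_def)

text \<open>
  By regularity \<open>x\<close> pairs with some vector, which can be corrected to an isotropic \<open>z\<close> with
  \<open>\<langle>x, z\<rangle> = 1\<close>; in the hyperbolic plane of \<open>x\<close> and \<open>z\<close> the vectors \<open>x/2 + z\<close> and \<open>-\<i> (x/2 - z)\<close> are
  orthonormal.
\<close>

lemma isotropic_vector_form:
  assumes S: "regular_subspace S" and x: "x \<in> S" "x \<noteq> 0" "\<langle>x, x\<rangle> = 0"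
  obtains u v where "u \<in> S" "v \<in> S" "\<langle>u, u\<rangle> = 1" "\<langle>v, v\<rangle> = 1" "\<langle>u, v\<rangle> = 0" "x = u + \<i> *\<^sub>C v"
proof -
  have sub: "csubspace S" using S by (simp add: regular_subspace_def)
  obtain z where z: "z \<in> S" "\<langle>x, z\<rangle> \<noteq> 0"
    using S x by (auto simp: regular_subspace_def)
  define z1 where "z1 = (1 / \<langle>x, z\<rangle>) *\<^sub>C z"
  define z2 where "z2 = z1 - (\<langle>z1, z1\<rangle> / 2) *\<^sub>C x"
  have "\<langle>x, z1\<rangle> = 1" using z by (simp add: z1_def form_scale_right)
  then have z2: "\<langle>x, z2\<rangle> = 1" "\<langle>z2, x\<rangle> = 1" "\<langle>z2, z2\<rangle> = 0"
    by (simp_all add: z2_def form_diff_left form_diff_right form_scale_left form_scale_right x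
        form_sym[of z1 x])
  define u where "u = (1/2) *\<^sub>C x + z2"
  define v where "v = (- \<i>) *\<^sub>C ((1/2) *\<^sub>C x - z2)"
  note closed = complex_vector.subspace_diff[OF sub] complex_vector.subspace_scale[OF sub]
    complex_vector.subspace_add[OF sub]
  have "z2 \<in> S" unfolding z1_def z2_def by (intro closed x(1) z(1))
  then have "u \<in> S" "v \<in> S" unfolding u_def v_def by (intro closed x(1); assumption)+
  moreover have "\<langle>u, u\<rangle> = 1" "\<langle>v, v\<rangle> = 1" "\<langle>u, v\<rangle> = 0"
    unfolding u_def v_def form_add_left form_add_right form_diff_left form_diff_right
      form_scale_left form_scale_right z2 x(3) by (simp_all add: algebra_simps)
  moreover have "x = u + \<i> *\<^sub>C v"
    by (simp add: u_def v_def scaleC_scaleC scaleC_one scaleC_add_left[symmetric])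
  ultimately show ?thesis using that by blast
qed

text \<open>
  A frame that puts \<open>x\<close> into normal form. This replaces Witt's theorem: vectors with equal invariants
  have equal coordinates in their adapted frames.
\<close>
lemma adapted_frame:
  assumes S: "regular_subspace S" and x: "x \<in> S"
  obtains e where "frame e (cdim S) S" "x = canonical_vector \<langle>x, x\<rangle> (x = 0) e"
    "admissible \<langle>x, x\<rangle> (x = 0) (cdim S)"
proof -
  note finish = that
  have finish_family: thesis
    if main: "orthonormal_family e m" "\<And>i. i < m \<Longrightarrow> e i \<in> S" "admissible \<langle>x, x\<rangle> (x = 0) m"
      "x = canonical_vector \<langle>x, x\<rangle> (x = 0) e" for e m
  proof -
    obtain e' n where e': "m \<le> n" "\<forall>i<m. e' i = e i" "frame e' n S"
      by (rule orthonormal_family_complete[OF S main(1,2)]) (assumption, rule that)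
    have "admissible \<langle>x, x\<rangle> (x = 0) n"
      using main(3) e'(1) by (auto simp: admissible_def split: if_splits)
    moreover have "canonical_vector \<langle>x, x\<rangle> (x = 0) e' = canonical_vector \<langle>x, x\<rangle> (x = 0) e"
      by (rule canonical_vector_cong[OF main(3), symmetric]) (simp add: e'(2))
    ultimately show thesis
      unfolding frame_dim[OF e'(3), symmetric]
      by (intro finish[of e'] trans[OF main(4)]) (use e'(3) frame_dim[OF e'(3)] in \<open>simp_all only:\<close>)
  qed
  consider "x = 0" | "\<langle>x, x\<rangle> \<noteq> 0" | "x \<noteq> 0" "\<langle>x, x\<rangle> = 0" by blast
  then show thesis
  proof cases
    case 1
    then show thesis
      by (intro finish_family[of "\<lambda>_. 0" 0])
        (simp_all add: orthonormal_family_def admissible_def canonical_vector_def)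
  next
    case 2
    define v where "v = (1 / csqrt \<langle>x, x\<rangle>) *\<^sub>C x"
    have v: "\<langle>v, v\<rangle> = 1" "csqrt \<langle>x, x\<rangle> *\<^sub>C v = x"
      unfolding v_def by (rule unit_multiple[OF 2])+
    have x0: "x \<noteq> 0" using 2 by auto
    show thesis
    proof (rule finish_family[of "\<lambda>_. v" 1])
      show "v \<in> S"
        using S x unfolding v_def regular_subspace_def by (blast intro: complex_vector.subspace_scale)
    qed (use 2 v x0 in \<open>simp_all add: orthonormal_family_def admissible_def canonical_vector_def\<close>)
  next
    case 3
    obtain u v where uv: "u \<in> S" "v \<in> S" "\<langle>u, u\<rangle> = 1" "\<langle>v, v\<rangle> = 1" "\<langle>u, v\<rangle> = 0" "x = u + \<i> *\<^sub>C v"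
      using isotropic_vector_form[OF S x 3] by blast
    have "\<langle>v, u\<rangle> = 0" using uv(5) form_sym[of v u] by simp
    show thesis
    proof (rule finish_family[of "\<lambda>i. if i = 0 then u else v" 2])
      show "orthonormal_family (\<lambda>i. if i = 0 then u else v) 2"
        using uv(3-5) \<open>\<langle>v, u\<rangle> = 0\<close> by (simp add: orthonormal_family_def less_2_cases_iff)
      show "x = canonical_vector \<langle>x, x\<rangle> (x = 0) (\<lambda>i. if i = 0 then u else v)"
        using 3 uv(6) by (simp add: canonical_vector_def)
    qed (use 3 uv(1,2) in \<open>auto simp: admissible_def\<close>)
  qed
qed

section \<open>Orthogonal complements\<close>

lemma csubspace_orth_compl: "csubspace (orth_compl S)"
  by (rule complex_vector.subspaceI) (auto simp: orth_compl_def form_add_left form_scale_left)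

lemma frame_split:
  assumes "csubspace S" "frame e n S"
  obtains p where "p \<in> S" "x - p \<in> orth_compl S"
proof -
  let ?p = "\<Sum>i<n. \<langle>x, e i\<rangle> *\<^sub>C e i"
  have "?p \<in> S" using assms
    by (intro complex_vector.subspace_sum complex_vector.subspace_scale frame_mem[OF assms(2)]) auto
  moreover have "\<langle>x - ?p, v\<rangle> = 0" if "v \<in> S" for v
  proof -
    have v: "(\<Sum>i<n. \<langle>v, e i\<rangle> *\<^sub>C e i) = v" by (rule frame_expansion[OF assms(2) that])
    have "\<langle>x - ?p, e i\<rangle> = 0" if "i < n" for i
      using orthonormal_family_coefficient[OF frame_family[OF assms(2)] that] by (simp add: form_diff_left)
    then have "\<langle>x - ?p, \<Sum>i<n. \<langle>v, e i\<rangle> *\<^sub>C e i\<rangle> = 0"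
      by (simp add: form_sum_right form_scale_right)
    then show ?thesis unfolding v .
  qed
  ultimately show ?thesis using that by (auto simp: orth_compl_def)
qed

lemma regular_split:
  assumes "regular_subspace S"
  obtains p where "p \<in> S" "x - p \<in> orth_compl S"
proof -
  have sub: "csubspace S" using assms by (simp add: regular_subspace_def)
  then obtain e where "frame e (cdim S) S"
    using adapted_frame[OF assms complex_vector.subspace_0[OF sub]] by blast
  then show ?thesis using frame_split[OF sub] that by blast
qed

lemma proj_eq_iff:
  assumes "regular_subspace S"
  shows "h' = proj S x \<longleftrightarrow> h' \<in> S \<and> x - h' \<in> orth_compl S"
proof -
  have sub: "csubspace S" using assms by (simp add: regular_subspace_def)
  obtain p where p: "p \<in> S" "x - p \<in> orth_compl S"
    by (rule regular_split[OF assms, of x])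
  have unique: "q = p" if "q \<in> S" "x - q \<in> orth_compl S" for q
  proof -
    have "p - q \<in> S" using complex_vector.subspace_diff[OF sub p(1) that(1)] .
    moreover have "(x - q) - (x - p) \<in> orth_compl S"
      by (rule complex_vector.subspace_diff[OF csubspace_orth_compl that(2) p(2)])
    then have "\<forall>v\<in>S. \<langle>p - q, v\<rangle> = 0" by (simp add: orth_compl_def)
    ultimately have "p - q = 0" using regular_subspaceD[OF assms] by blast
    then show ?thesis by (simp only: right_minus_eq)
  qed
  then have "proj S x = p" unfolding proj_def
    by (intro the_equality conjI p) (elim conjE, rule unique)
  then show ?thesis
  proof (intro iffI)
    assume "h' \<in> S \<and> x - h' \<in> orth_compl S"
    then show "h' = proj S x" using unique[of h'] \<open>proj S x = p\<close> by simp
  qed (simp add: p)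
qed

lemma mem_Reg_iff: "(S, h') \<in> Reg h \<longleftrightarrow> regular_subspace S \<and> h' \<in> S \<and> h - h' \<in> orth_compl S"
proof (cases "regular_subspace S")
  case True
  then show ?thesis using proj_eq_iff[OF True, of h' h] by (simp add: Reg_def)
qed (simp add: Reg_def)

lemma regular_orth_compl:
  assumes "regular_subspace S"
  shows "regular_subspace (orth_compl S)"
  unfolding regular_subspace_def
proof (intro conjI ballI impI)
  fix u assume u: "u \<in> orth_compl S" "\<forall>v\<in>orth_compl S. \<langle>u, v\<rangle> = 0"
  have "\<langle>u, x\<rangle> = 0" for x
  proof -
    obtain p where "p \<in> S" "x - p \<in> orth_compl S"
    by (rule regular_split[OF assms, of x])
    then have "\<langle>u, p\<rangle> = 0" "\<langle>u, x - p\<rangle> = 0" using u by (auto simp: orth_compl_def)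
    then show ?thesis by (simp add: form_diff_right)
  qed
  then show "u = 0" by (intro form_nondegenerate allI)
qed (rule csubspace_orth_compl)

lemma sum_lessThan_add: "(\<Sum>i<k + m :: nat. f i) = (\<Sum>i<k. f i) + (\<Sum>i<m. f (k + i) :: 'b::comm_monoid_add)"
  by (induction m) (simp_all add: add.assoc)

lemma frame_append:
  assumes S: "regular_subspace S" "frame e k S" and f: "frame f m (orth_compl S)"
  shows "frame (\<lambda>i. if i < k then e i else f (i - k)) (k + m) UNIV"
proof -
  let ?g = "\<lambda>i. if i < k then e i else f (i - k)"
  have perp: "\<langle>f j, e i\<rangle> = 0" "\<langle>e i, f j\<rangle> = 0" if "i < k" "j < m" for i j
    using frame_mem[OF S(2) that(1)] frame_mem[OF f that(2)]
    by (auto simp: orth_compl_def form_sym[of "e i"])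
  have "orthonormal_family ?g (k + m)"
    unfolding orthonormal_family_def
  proof (intro allI impI)
    fix i j assume ij: "i < k + m" "j < k + m"
    have e: "\<langle>e i, e j\<rangle> = (if i = j then 1 else 0)" if "i < k" "j < k"
      by (rule frame_form[OF S(2) that])
    have f: "\<langle>f (i - k), f (j - k)\<rangle> = (if i = j then 1 else 0)" if "\<not> i < k" "\<not> j < k"
    proof -
      have "i - k < m" "j - k < m" "i - k = j - k \<longleftrightarrow> i = j" using ij that by auto
      then show ?thesis using frame_form[OF f, of "i - k" "j - k"] by simp
    qed
    show "\<langle>?g i, ?g j\<rangle> = (if i = j then 1 else 0)"
      using e f perp ij by (cases "i < k"; cases "j < k") auto
  qed
  moreover have "x = (\<Sum>i<k + m. \<langle>x, ?g i\<rangle> *\<^sub>C ?g i)" for x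
  proof -
    obtain p where p: "p \<in> S" "x - p \<in> orth_compl S"
      by (rule regular_split[OF S(1), of x])
    have "p = (\<Sum>i<k. \<langle>p, e i\<rangle> *\<^sub>C e i)" by (rule frame_expansion[OF S(2) p(1), symmetric])
    also have "\<dots> = (\<Sum>i<k. \<langle>x, e i\<rangle> *\<^sub>C e i)"
      using frame_mem[OF S(2)] p by (intro sum.cong refl) (simp add: orth_compl_def form_diff_left)
    finally have 1: "p = (\<Sum>i<k. \<langle>x, e i\<rangle> *\<^sub>C e i)" .
    have "x - p = (\<Sum>i<m. \<langle>x - p, f i\<rangle> *\<^sub>C f i)" by (rule frame_expansion[OF f p(2), symmetric])
    also have "\<dots> = (\<Sum>i<m. \<langle>x, f i\<rangle> *\<^sub>C f i)"
      using frame_mem[OF f] p by (intro sum.cong refl)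
        (simp add: orth_compl_def form_diff_left form_sym[of p])
    finally have 2: "x - p = (\<Sum>i<m. \<langle>x, f i\<rangle> *\<^sub>C f i)" .
    have "x = p + (x - p)" by simp
    also have "\<dots> = (\<Sum>i<k + m. \<langle>x, ?g i\<rangle> *\<^sub>C ?g i)"
      unfolding 2 unfolding 1 sum_lessThan_add by simp
    finally show ?thesis .
  qed
  ultimately show ?thesis unfolding frame_def by blast
qed

section \<open>Isometries acting on \<open>Reg(\<h>)\<^sub>h\<close>\<close>

lemma frame_transport:
  assumes "frame e n UNIV" "frame e' n UNIV"
  obtains g where "form_isometry g" "\<forall>i<n. g (e i) = e' i"
proof -
  define T where "T e e' x = (\<Sum>i<n. \<langle>x, e i\<rangle> *\<^sub>C e' i)" for e e' :: "nat \<Rightarrow> 'a" and x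
  have linear: "clinear (T e e')" for e e'
    by (simp add: T_def clinear_iff form_add_left form_scale_left scaleC_add_left sum.distrib
        complex_vector.scale_sum_right scaleC_scaleC)
  have coeff: "\<langle>T e e' x, e' i\<rangle> = \<langle>x, e i\<rangle>" if "frame e' n UNIV" "i < n" for e e' x i
    using orthonormal_family_coefficient[OF frame_family[OF that(1)] that(2)] by (simp add: T_def)
  have inverse: "T e' e (T e e' x) = x" if "frame e n UNIV" "frame e' n UNIV" for e e' x
  proof -
    have "T e' e (T e e' x) = (\<Sum>i<n. \<langle>x, e i\<rangle> *\<^sub>C e i)"
      using coeff[OF that(2)] by (simp add: T_def[of e'])
    then show ?thesis by (simp add: frame_expansion[OF that(1)])
  qed
  have "bij (T e e')"
    by (rule bij_betw_byWitness[of UNIV "T e' e"]) (auto simp: inverse assms)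
  moreover have "\<langle>T e e' x, T e e' y\<rangle> = \<langle>x, y\<rangle>" for x y
  proof -
    have "\<langle>T e e' x, T e e' y\<rangle> = (\<Sum>i<n. \<langle>y, e i\<rangle> * \<langle>x, e i\<rangle>)"
      unfolding T_def[of e e' y] form_sum_right form_scale_right using coeff[OF assms(2)] by simp
    also have "\<dots> = \<langle>x, \<Sum>i<n. \<langle>y, e i\<rangle> *\<^sub>C e i\<rangle>"
      by (simp add: form_sum_right form_scale_right)
    also have "(\<Sum>i<n. \<langle>y, e i\<rangle> *\<^sub>C e i) = y" by (simp add: frame_expansion[OF assms(1)])
    finally show ?thesis .
  qed
  ultimately have "form_isometry (T e e')" using linear by (simp add: form_isometry_def)
  moreover have "T e e' (e i) = e' i" if "i < n" for i
  proof -
    have "T e e' (e i) = (\<Sum>j<n. if i = j then e' j else 0)"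
      unfolding T_def using assms(1) that
      by (intro sum.cong refl) (simp add: frame_form scaleC_one)
    then show ?thesis using that by simp
  qed
  ultimately show ?thesis using that by blast
qed

text \<open>
  A complete set of invariants of the orbits. The norm of \<open>h - h'\<close> is determined by that of \<open>h'\<close>, and
  the two flags tell when \<open>h'\<close> or \<open>h - h'\<close> is zero rather than merely isotropic.
\<close>

definition reg_type :: "'h::quadratic_space \<Rightarrow> 'h set \<times> 'h \<Rightarrow> nat \<times> complex \<times> bool \<times> bool"
  where "reg_type h p = (cdim (fst p), \<langle>snd p, snd p\<rangle>, snd p = 0, snd p = h)"

lemma Reg_norm_complement:
  assumes "(S, h') \<in> Reg h"
  shows "\<langle>h - h', h - h'\<rangle> = \<langle>h, h\<rangle> - \<langle>h', h'\<rangle>"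
proof -
  have "\<langle>h, h'\<rangle> = \<langle>h', h'\<rangle>" using assms by (simp add: mem_Reg_iff orth_compl_def form_diff_left)
  then show ?thesis by (simp add: form_diff_left form_diff_right form_sym[of h' h])
qed

lemma regular_UNIV: "regular_subspace UNIV"
  using form_nondegenerate by (auto simp: regular_subspace_def)

text \<open>
  Adapted frames for \<open>h'\<close> in \<open>S\<close> and for \<open>h - h'\<close> in the orthogonal complement form together a frame
  of the whole space, in which all of \<open>S\<close>, \<open>h'\<close> and \<open>h\<close> are determined by the invariants.
\<close>
lemma Reg_normal_form:
  assumes "(S, h') \<in> Reg (h :: 'h::quadratic_space)"
  defines "k \<equiv> cdim S" and "d \<equiv> cdim (UNIV :: 'h set)" and "y \<equiv> \<langle>h', h'\<rangle>"
  shows "k \<le> d" "admissible y (h' = 0) k" "admissible (\<langle>h, h\<rangle> - y) (h' = h) (d - k)"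
    and "\<exists>e. frame e d UNIV \<and> S = cspan (e ` {..<k}) \<and> h' = canonical_vector y (h' = 0) e \<and>
      h - h' = canonical_vector (\<langle>h, h\<rangle> - y) (h' = h) (\<lambda>i. e (k + i))"
proof -
  have S: "regular_subspace S" "h' \<in> S" "h - h' \<in> orth_compl S"
    using assms(1) by (auto simp: mem_Reg_iff)
  define m where "m = cdim (orth_compl S)"
  obtain e where e: "frame e k S" "h' = canonical_vector y (h' = 0) e" "admissible y (h' = 0) k"
    by (rule adapted_frame[OF S(1,2), folded k_def y_def])
  have "h - h' = 0 \<longleftrightarrow> h' = h" by auto
  note complement = this Reg_norm_complement[OF assms(1), folded y_def]
  obtain f where f: "frame f m (orth_compl S)"
      "h - h' = canonical_vector (\<langle>h, h\<rangle> - y) (h' = h) f" "admissible (\<langle>h, h\<rangle> - y) (h' = h) m"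
    by (rule adapted_frame[OF regular_orth_compl[OF S(1)] S(3), folded m_def, unfolded complement])
  let ?g = "\<lambda>i. if i < k then e i else f (i - k)"
  have g: "frame ?g (k + m) UNIV" by (rule frame_append[OF S(1) e(1) f(1)])
  have d: "d = k + m" using frame_dim[OF g] by (simp add: d_def)
  then show "k \<le> d" "admissible y (h' = 0) k" "admissible (\<langle>h, h\<rangle> - y) (h' = h) (d - k)"
    using e(3) f(3) by simp_all
  have "cspan (e ` {..<k}) \<subseteq> S"
    using frame_mem[OF e(1)] S(1) by (intro complex_vector.span_minimal) (auto simp: regular_subspace_def)
  then have "S = cspan (e ` {..<k})" using frame_span[OF e(1)] by blast
  also have "e ` {..<k} = ?g ` {..<k}" by auto
  finally have "S = cspan (?g ` {..<k})" .
  moreover have "h' = canonical_vector y (h' = 0) ?g"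
    by (rule trans[OF e(2) canonical_vector_cong[OF e(3)]]) simp
  moreover have "h - h' = canonical_vector (\<langle>h, h\<rangle> - y) (h' = h) (\<lambda>i. ?g (k + i))"
    by (rule trans[OF f(2)]) simp
  ultimately show "\<exists>e. frame e d UNIV \<and> S = cspan (e ` {..<k}) \<and> h' = canonical_vector y (h' = 0) e \<and>
      h - h' = canonical_vector (\<langle>h, h\<rangle> - y) (h' = h) (\<lambda>i. e (k + i))"
    using g unfolding d by (intro exI[of _ ?g] conjI)
qed

text \<open>The isometry that matches the two normal form frames fixes \<open>h\<close>, the sum of the two canonical
  vectors.\<close>
lemma isometry_of_same_type:
  assumes "p \<in> Reg (h :: 'h::quadratic_space)" "q \<in> Reg h" "reg_type h p = reg_type h q"
  obtains g where "form_isometry g" "g h = h" "q = (g ` fst p, g (snd p))"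
proof -
  define d where "d = cdim (UNIV :: 'h set)"
  define k where "k = cdim (fst p)"
  define y where "y = \<langle>snd p, snd p\<rangle>"
  define z where "z \<longleftrightarrow> snd p = 0"
  define w where "w \<longleftrightarrow> snd p = h"
  have q: "cdim (fst q) = k" "\<langle>snd q, snd q\<rangle> = y" "(snd q = 0) = z" "(snd q = h) = w"
    using assms(3) by (auto simp: reg_type_def k_def y_def z_def w_def)
  have p_Reg: "(fst p, snd p) \<in> Reg h" and q_Reg: "(fst q, snd q) \<in> Reg h" using assms by simp_all
  have "k \<le> d" and adm: "admissible y z k" "admissible (\<langle>h, h\<rangle> - y) w (d - k)"
    using Reg_normal_form(1-3)[OF p_Reg] by (simp_all add: k_def d_def y_def z_def w_def)
  obtain e where e: "frame e d UNIV" "fst p = cspan (e ` {..<k})" "snd p = canonical_vector y z e"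
      "h - snd p = canonical_vector (\<langle>h, h\<rangle> - y) w (\<lambda>i. e (k + i))"
    using Reg_normal_form(4)[OF p_Reg] unfolding k_def d_def y_def z_def w_def by blast
  obtain f where f: "frame f d UNIV" "fst q = cspan (f ` {..<k})" "snd q = canonical_vector y z f"
      "h - snd q = canonical_vector (\<langle>h, h\<rangle> - y) w (\<lambda>i. f (k + i))"
    using Reg_normal_form(4)[OF q_Reg] unfolding q d_def by blast
  obtain g where g: "form_isometry g" "\<forall>i<d. g (e i) = f i"
    using frame_transport[OF e(1) f(1)] by blast
  have lin: "clinear g" using g(1) by (simp add: form_isometry_def)
  have "g ` fst p = cspan (g ` e ` {..<k})"
    unfolding e(2) by (rule module_hom.span_image[OF clinear_module_hom[OF lin], symmetric, folded cspan_def])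
  also have "g ` e ` {..<k} = f ` {..<k}"
    unfolding image_image using g(2) \<open>k \<le> d\<close> by (intro image_cong) auto
  finally have S: "g ` fst p = fst q" by (simp add: f(2))
  have h': "g (snd p) = snd q"
    unfolding e(3) f(3) canonical_vector_image[OF lin]
    using g(2) \<open>k \<le> d\<close> by (intro canonical_vector_cong[OF adm(1)]) auto
  have "g (h - snd p) = h - snd q"
    unfolding e(4) f(4) canonical_vector_image[OF lin]
    using g(2) \<open>k \<le> d\<close> by (intro canonical_vector_cong[OF adm(2)]) auto
  then have "g h = h" by (simp add: clinear_diff[OF lin] h')
  then show ?thesis using that[OF g(1)] S h' by (simp add: prod_eq_iff)
qed

lemma isometry_preserves_type:
  assumes g: "form_isometry g" and p: "(S, h') \<in> Reg h"
  shows "(g ` S, g h') \<in> Reg (g h)" "reg_type (g h) (g ` S, g h') = reg_type h (S, h')"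
proof -
  have lin: "clinear g" and form: "\<And>x y. \<langle>g x, g y\<rangle> = \<langle>x, y\<rangle>" and inj: "\<And>x y. g x = g y \<longleftrightarrow> x = y"
    using g by (auto simp: form_isometry_def dest: bij_is_inj injD)
  obtain e where e: "frame e (cdim (UNIV :: 'a set)) UNIV" "S = cspan (e ` {..<cdim S})"
    using Reg_normal_form(4)[OF p] by blast
  have le: "cdim S \<le> cdim (UNIV :: 'a set)" by (rule Reg_normal_form(1)[OF p])
  have "orthonormal_family (g \<circ> e) (cdim S)"
    using frame_form[OF e(1)] le by (simp add: orthonormal_family_def form)
  from frame_of_span[OF this]
  have "frame (g \<circ> e) (cdim S) (cspan ((g \<circ> e) ` {..<cdim S}))" .
  also have "cspan ((g \<circ> e) ` {..<cdim S}) = g ` cspan (e ` {..<cdim S})"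
    unfolding image_comp[symmetric]
    by (rule module_hom.span_image[OF clinear_module_hom[OF lin], folded cspan_def])
  finally have fr: "frame (g \<circ> e) (cdim S) (g ` S)" by (simp only: e(2)[symmetric])
  have "csubspace (g ` S)"
    by (metis e(2) \<open>cspan ((g \<circ> e) ` {..<cdim S}) = g ` cspan (e ` {..<cdim S})\<close> complex_vector.subspace_span)
  then have "regular_subspace (g ` S)" using fr by (rule frame_regular)
  then show "(g ` S, g h') \<in> Reg (g h)"
    using p by (auto simp: mem_Reg_iff orth_compl_def form simp flip: clinear_diff[OF lin])
  show "reg_type (g h) (g ` S, g h') = reg_type h (S, h')"
    using frame_dim[OF fr] inj[of h' 0] by (simp add: reg_type_def form inj clinear_zero[OF lin])
qed

lemma anisotropic_frame:
  assumes "\<langle>x, x\<rangle> \<noteq> 0"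
  obtains e where "frame e (cdim (UNIV :: 'h::quadratic_space set)) UNIV"
    "(x :: 'h) = csqrt \<langle>x, x\<rangle> *\<^sub>C e 0" "0 < cdim (UNIV :: 'h set)"
proof -
  obtain e where e: "frame e (cdim (UNIV :: 'h set)) UNIV" "x = canonical_vector \<langle>x, x\<rangle> (x = 0) e"
      "admissible \<langle>x, x\<rangle> (x = 0) (cdim (UNIV :: 'h set))"
    by (rule adapted_frame[OF regular_UNIV UNIV_I[of x]])
  have x: "x \<noteq> 0" using assms by auto
  have "canonical_vector \<langle>x, x\<rangle> (x = 0) e = csqrt \<langle>x, x\<rangle> *\<^sub>C e 0"
    using assms x by (simp add: canonical_vector_def)
  with e(2) have "x = csqrt \<langle>x, x\<rangle> *\<^sub>C e 0" by (rule trans)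
  moreover have "0 < cdim (UNIV :: 'h set)" using e(3) assms x by (simp add: admissible_def)
  ultimately show ?thesis using that[OF e(1)] by blast
qed

lemma anisotropic_transitive:
  assumes "\<langle>v, v\<rangle> = \<langle>h, h\<rangle>" "\<langle>h, h\<rangle> \<noteq> 0"
  obtains g where "form_isometry g" "g v = h"
proof -
  obtain e where e: "frame e (cdim (UNIV :: 'a set)) UNIV" "v = csqrt \<langle>v, v\<rangle> *\<^sub>C e 0"
      "0 < cdim (UNIV :: 'a set)"
    using anisotropic_frame[of v] assms by metis
  obtain f where f: "frame f (cdim (UNIV :: 'a set)) UNIV" "h = csqrt \<langle>h, h\<rangle> *\<^sub>C f 0"
    using anisotropic_frame[OF assms(2)] by blast
  obtain g where g: "form_isometry g" "\<forall>i<cdim (UNIV :: 'a set). g (e i) = f i"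
    using frame_transport[OF e(1) f(1)] by blast
  have lin: "clinear g" using g(1) by (simp add: form_isometry_def)
  have "g v = g (csqrt \<langle>v, v\<rangle> *\<^sub>C e 0)" by (rule arg_cong[OF e(2)])
  also have "\<dots> = csqrt \<langle>h, h\<rangle> *\<^sub>C f 0" using g(2) e(3) by (simp add: clinear_scale[OF lin] assms(1))
  finally show ?thesis using that[OF g(1)] f(2) by simp
qed

text \<open>
  In any frame the canonical vectors of the first \<open>k\<close> and of the remaining basis vectors add up to a
  vector \<open>v\<close> with the norm of \<open>h\<close>. This gives an element of the prescribed type for \<open>v\<close> in place of
  \<open>h\<close>, and an isometry carries \<open>v\<close> to \<open>h\<close> since both are anisotropic.
\<close>
lemma Reg_type_realized:
  fixes h :: "'h::quadratic_space"
  assumes h: "\<langle>h, h\<rangle> \<noteq> 0" and k: "k \<le> cdim (UNIV :: 'h set)"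
    and adm: "admissible y z k" "admissible (\<langle>h, h\<rangle> - y) w (cdim (UNIV :: 'h set) - k)"
  obtains p where "p \<in> Reg h" "reg_type h p = (k, y, z, w)"
proof -
  define d where "d = cdim (UNIV :: 'h set)"
  obtain e :: "nat \<Rightarrow> 'h" where e: "frame e d UNIV"
    using adapted_frame[OF regular_UNIV] unfolding d_def by blast
  have on: "orthonormal_family e d" by (rule frame_family[OF e])
  have on1: "orthonormal_family e k" and on2: "orthonormal_family (\<lambda>i. e (k + i)) (d - k)"
    using on k by (auto simp: orthonormal_family_def d_def)
  define S where "S = cspan (e ` {..<k})"
  define v1 where "v1 = canonical_vector y z e"
  define v2 where "v2 = canonical_vector (\<langle>h, h\<rangle> - y) w (\<lambda>i. e (k + i))"
  note adm2 = adm(2)[folded d_def]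
  have fr: "frame e k S" unfolding S_def by (rule frame_of_span[OF on1])
  have sub: "csubspace S" by (simp add: S_def)
  have v1: "v1 \<in> S" unfolding v1_def S_def by (rule canonical_vector_in_span[OF adm(1)])
  have "e (k + i) \<in> orth_compl S" if "i < d - k" for i
  proof -
    have "\<langle>e (k + i), v\<rangle> = 0" if "v \<in> S" for v
    proof (rule clinear_eq_on_span[of "\<lambda>v. \<langle>e (k + i), v\<rangle>" "\<lambda>_. 0", OF clinear_form_right])
      show "v \<in> cspan (e ` {..<k})" using that by (simp add: S_def)
      show "\<langle>e (k + i), x\<rangle> = 0" if "x \<in> e ` {..<k}" for x
        using on that \<open>i < d - k\<close> by (auto simp: orthonormal_family_def)
    qed (simp add: clinear_iff)
    then show ?thesis by (simp add: orth_compl_def)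
  qed
  then have "cspan ((\<lambda>i. e (k + i)) ` {..<d - k}) \<subseteq> orth_compl S"
    by (intro complex_vector.span_minimal csubspace_orth_compl) auto
  then have v2: "v2 \<in> orth_compl S"
    using canonical_vector_in_span[OF adm2] unfolding v2_def by blast
  have n1: "\<langle>v1, v1\<rangle> = y" unfolding v1_def by (rule canonical_vector_norm[OF adm(1) on1])
  have n2: "\<langle>v2, v2\<rangle> = \<langle>h, h\<rangle> - y" unfolding v2_def by (rule canonical_vector_norm[OF adm2 on2])
  have z: "v1 = 0 \<longleftrightarrow> z" unfolding v1_def by (rule canonical_vector_eq_0[OF adm(1) on1])
  have w: "v2 = 0 \<longleftrightarrow> w" unfolding v2_def by (rule canonical_vector_eq_0[OF adm2 on2])
  define v where "v = v1 + v2"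
  have "\<langle>v2, v1\<rangle> = 0" using v1 v2 by (simp add: orth_compl_def)
  then have v: "\<langle>v, v\<rangle> = \<langle>h, h\<rangle>"
    by (simp add: v_def form_add_left form_add_right form_sym[of v1 v2] n1 n2)
  have Reg: "(S, v1) \<in> Reg v"
    using frame_regular[OF sub fr] v1 v2 by (simp add: mem_Reg_iff v_def)
  have type: "reg_type v (S, v1) = (k, y, z, w)"
    using z w n1 frame_dim[OF fr] by (simp add: reg_type_def v_def)
  obtain g where g: "form_isometry g" "g v = h"
    using anisotropic_transitive[OF v h] by blast
  show ?thesis
    using isometry_preserves_type[OF g(1) Reg] type g(2) by (intro that[of "(g ` S, g v1)"]) simp_all
qed

section \<open>Classification of the orbits\<close>

definition Reg_fiber :: "'h::quadratic_space \<Rightarrow> nat \<times> complex \<times> bool \<times> bool \<Rightarrow> ('h set \<times> 'h) set"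
  where "Reg_fiber h t = {p \<in> Reg h. reg_type h p = t}"

definition realizable_types :: "nat \<Rightarrow> complex \<Rightarrow> (nat \<times> complex \<times> bool \<times> bool) set"
  where "realizable_types d c =
    {(k, y, z, w). k \<le> d \<and> admissible y z k \<and> admissible (c - y) w (d - k)}"

lemma reg_type_image:
  fixes h :: "'h::quadratic_space"
  assumes "\<langle>h, h\<rangle> \<noteq> 0"
  shows "reg_type h ` Reg h = realizable_types (cdim (UNIV :: 'h set)) \<langle>h, h\<rangle>"
proof (intro equalityI subsetI)
  fix t assume "t \<in> reg_type h ` Reg h"
  then obtain S h' where p: "(S, h') \<in> Reg h" "t = reg_type h (S, h')" by auto
  then show "t \<in> realizable_types (cdim (UNIV :: 'h set)) \<langle>h, h\<rangle>"
    using Reg_normal_form(1-3)[OF p(1)] by (simp add: realizable_types_def reg_type_def)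
next
  fix t assume "t \<in> realizable_types (cdim (UNIV :: 'h set)) \<langle>h, h\<rangle>"
  then obtain k y z w where t: "t = (k, y, z, w)" "k \<le> cdim (UNIV :: 'h set)" "admissible y z k"
      "admissible (\<langle>h, h\<rangle> - y) w (cdim (UNIV :: 'h set) - k)"
    by (auto simp: realizable_types_def)
  obtain p where "p \<in> Reg h" "reg_type h p = (k, y, z, w)"
    by (rule Reg_type_realized[OF assms t(2-4)])
  then show "t \<in> reg_type h ` Reg h" using t(1) by (metis imageI)
qed

lemma isometry_orbit:
  assumes "p \<in> Reg h"
  shows "{(g ` fst p, g (snd p)) | g. form_isometry g \<and> g h = h} = Reg_fiber h (reg_type h p)"
proof (intro equalityI subsetI)
  fix q assume "q \<in> {(g ` fst p, g (snd p)) | g. form_isometry g \<and> g h = h}"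
  then obtain g where g: "q = (g ` fst p, g (snd p))" "form_isometry g" "g h = h" by blast
  show "q \<in> Reg_fiber h (reg_type h p)"
    using isometry_preserves_type[OF g(2), of "fst p" "snd p" h] assms g
    by (simp add: Reg_fiber_def)
next
  fix q assume "q \<in> Reg_fiber h (reg_type h p)"
  then have q: "q \<in> Reg h" "reg_type h p = reg_type h q" by (simp_all add: Reg_fiber_def)
  obtain g where "form_isometry g" "g h = h" "q = (g ` fst p, g (snd p))"
    by (rule isometry_of_same_type[OF assms q])
  then show "q \<in> {(g ` fst p, g (snd p)) | g. form_isometry g \<and> g h = h}" by blast
qed

lemma Reg_orbits_eq_fibers:
  fixes h :: "'h::quadratic_space"
  assumes h: "\<langle>h, h\<rangle> \<noteq> 0" and G: "restrict_h ` G = {g. form_isometry g \<and> g h = h}"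
  shows "Reg_orbits G h = Reg_fiber h ` realizable_types (cdim (UNIV :: 'h set)) \<langle>h, h\<rangle>"
proof -
  have "{reg_act \<sigma> p | \<sigma>. \<sigma> \<in> G} = Reg_fiber h (reg_type h p)" if "p \<in> Reg h" for p
  proof -
    have "{reg_act \<sigma> p | \<sigma>. \<sigma> \<in> G} = (\<lambda>g. (g ` fst p, g (snd p))) ` restrict_h ` G"
      by (auto simp: reg_act_def)
    also have "\<dots> = {(g ` fst p, g (snd p)) | g. form_isometry g \<and> g h = h}"
      unfolding G by blast
    finally show ?thesis using isometry_orbit[OF that] by simp
  qed
  then have "Reg_orbits G h = (\<lambda>p. Reg_fiber h (reg_type h p)) ` Reg h"
    unfolding Reg_orbits_def Setcompr_eq_image Collect_mem_eq by (intro image_cong refl) (simp only: Setcompr_eq_image Collect_mem_eq)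
  then show ?thesis by (simp add: image_image flip: reg_type_image[OF h])
qed

text \<open>
  The ranges of \<open>k\<close> come from the two spaces: a nonzero vector needs dimension \<open>1\<close>, or \<open>2\<close> if it is
  isotropic. For the norms \<open>0\<close> and \<open>c\<close> the isotropic vector lies in \<open>S\<close> and in its complement,
  respectively.
\<close>
lemma realizable_types_eq:
  assumes "c \<noteq> 0" "0 < d"
  shows "realizable_types d c =
    (\<lambda>k. (k, c, False, True)) ` {1..d} \<union>
    (\<lambda>k. (k, 0, True, False)) ` {0..d - 1} \<union>
    (\<lambda>(k, y). (k, y, False, False)) ` ({1..d - 1} \<times> {y. y \<noteq> 0 \<and> y \<noteq> c}) \<union>
    (\<lambda>k. (k, c, False, False)) ` {1..d - 2} \<union>
    (\<lambda>k. (k, 0, False, False)) ` {2..d - 1}" (is "_ = ?R")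
proof (rule set_eqI)
  fix t :: "nat \<times> complex \<times> bool \<times> bool"
  obtain k y z w where t: "t = (k, y, z, w)" by (cases t)
  have "t \<in> ?R \<longleftrightarrow>
      y = c \<and> \<not> z \<and> w \<and> 1 \<le> k \<and> k \<le> d \<or>
      y = 0 \<and> z \<and> \<not> w \<and> k \<le> d - 1 \<or>
      y \<noteq> 0 \<and> y \<noteq> c \<and> \<not> z \<and> \<not> w \<and> 1 \<le> k \<and> k \<le> d - 1 \<or>
      y = c \<and> \<not> z \<and> \<not> w \<and> 1 \<le> k \<and> k \<le> d - 2 \<or>
      y = 0 \<and> \<not> z \<and> \<not> w \<and> 2 \<le> k \<and> k \<le> d - 1"
    unfolding t by (cases z; cases w) (simp_all add: image_iff Bex_def, blast+)
  also have "\<dots> \<longleftrightarrow> k \<le> d \<and> admissible y z k \<and> admissible (c - y) w (d - k)"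
  proof -
    have zero: "c - y = 0 \<longleftrightarrow> y = c" by auto
    consider "y = 0" "y \<noteq> c" | "y = c" "y \<noteq> 0" | "y \<noteq> 0" "y \<noteq> c"
      using assms(1) by blast
    then show ?thesis
    proof cases
      case 1
      then show ?thesis using assms(2) by (cases z; cases w) (simp_all add: admissible_def zero, arith+)
    next
      case 2
      then show ?thesis using assms(2) by (cases z; cases w) (simp_all add: admissible_def, arith+)
    next
      case 3
      then show ?thesis using assms(2) by (cases z; cases w) (simp_all add: admissible_def zero, arith+)
    qed
  qed
  finally show "t \<in> realizable_types d c \<longleftrightarrow> t \<in> ?R"
    by (simp add: realizable_types_def t)
qed

text \<open>
  The sets \<open>I4\<close> and \<open>I5\<close> are the exceptional members of the family \<open>I3\<close>, at \<open>y = \<langle>h, h\<rangle>\<close> and \<open>y = 0\<close>.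
\<close>

lemma Reg_fiber_cases:
  assumes "h \<noteq> 0" "\<langle>h, h\<rangle> \<noteq> 0"
  shows "Reg_fiber h (k, \<langle>h, h\<rangle>, False, True) = I1 h k"
    and "Reg_fiber h (k, 0, True, False) = I2 h k"
    and "Reg_fiber h (k, y, False, False) = I3 h k y"
    and "I3 h k \<langle>h, h\<rangle> = I4 h k"
    and "I3 h k 0 = I5 h k"
  using assms
  by (auto simp: Reg_fiber_def reg_type_def I1_def I2_def I3_def I4_def I5_def)

lemma Union_Reg_orbits:
  fixes h :: "'h::quadratic_space"
  assumes "\<langle>h, h\<rangle> \<noteq> 0"
  shows "\<Union> (Reg_fiber h ` realizable_types (cdim (UNIV :: 'h set)) \<langle>h, h\<rangle>) = Reg h"
  by (auto simp: Reg_fiber_def simp flip: reg_type_image[OF assms])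

theorem theorem1p4:
  fixes h :: "'h::quadratic_space"
    and d :: nat
    and Y :: "'h heis \<Rightarrow> int \<Rightarrow> 'h heis \<Rightarrow> 'h heis"
    and B :: "'h set"
    and G :: "('h heis \<Rightarrow> 'h heis) set"
  assumes dim: "cdim (UNIV :: 'h set) = d"
    and h_nonzero: "h \<noteq> 0"
    and h_anisotropic: "\<langle>h, h\<rangle> \<noteq> 0"
    and vertex_algebra: "vertex_algebra vac Y"
    and Y_generators: "\<And>u n. Y (mode u (-1) vac) n = mode u n"
    and orthonormal: "orthonormal_basis B"
    and G: "G = conformal_aut Y (conformal_vector B h)"
  shows "Reg_orbits G h =
           {I1 h k | k. k \<in> {1..d}} \<union>
           {I2 h k | k. k \<in> {0..d - 1}} \<union>
           {I3 h k y | k y. k \<in> {1..d - 1} \<and> y \<noteq> 0 \<and> y \<noteq> \<langle>h, h\<rangle>} \<union>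
           {I4 h k | k. k \<in> {1..d - 2}} \<union>
           {I5 h k | k. k \<in> {2..d - 1}}
       \<and> Reg h =
           (\<Union>k\<in>{1..d}. I1 h k) \<union>
           (\<Union>k\<in>{0..d - 1}. I2 h k) \<union>
           (\<Union>k\<in>{1..d - 1}. \<Union>y\<in>{y. y \<noteq> 0 \<and> y \<noteq> \<langle>h, h\<rangle>}. I3 h k y) \<union>
           (\<Union>k\<in>{1..d - 2}. I4 h k) \<union>
           (\<Union>k\<in>{2..d - 1}. I5 h k)"
proof -
  interpret heisenberg_vertex_algebra Y
    using vertex_algebra Y_generators by unfold_locales
  have "0 < d"
    using anisotropic_frame[OF h_anisotropic] dim by metis
  have orbits: "Reg_fiber h ` realizable_types d \<langle>h, h\<rangle> =
      I1 h ` {1..d} \<union> I2 h ` {0..d - 1} \<union>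
      (\<lambda>(k, y). I3 h k y) ` ({1..d - 1} \<times> {y. y \<noteq> 0 \<and> y \<noteq> \<langle>h, h\<rangle>}) \<union>
      I4 h ` {1..d - 2} \<union> I5 h ` {2..d - 1}"
    by (simp add: realizable_types_eq[OF h_anisotropic \<open>0 < d\<close>] image_Un image_image split_def
        Reg_fiber_cases[OF h_nonzero h_anisotropic])
  have "Reg_orbits G h = Reg_fiber h ` realizable_types d \<langle>h, h\<rangle>"
    unfolding G dim[symmetric]
    by (rule Reg_orbits_eq_fibers[OF h_anisotropic restrict_h_conformal_aut[OF orthonormal]])
  also have "\<dots> = {I1 h k | k. k \<in> {1..d}} \<union>
           {I2 h k | k. k \<in> {0..d - 1}} \<union>
           {I3 h k y | k y. k \<in> {1..d - 1} \<and> y \<noteq> 0 \<and> y \<noteq> \<langle>h, h\<rangle>} \<union>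
           {I4 h k | k. k \<in> {1..d - 2}} \<union>
           {I5 h k | k. k \<in> {2..d - 1}}"
  proof -
    have "(\<lambda>(k, y). I3 h k y) ` ({1..d - 1} \<times> {y. y \<noteq> 0 \<and> y \<noteq> \<langle>h, h\<rangle>}) =
        {I3 h k y | k y. k \<in> {1..d - 1} \<and> y \<noteq> 0 \<and> y \<noteq> \<langle>h, h\<rangle>}"
      by fast
    then show ?thesis unfolding orbits by (simp only: Setcompr_eq_image Collect_mem_eq)
  qed
  finally have 1: "Reg_orbits G h = \<dots>" .
  have product: "(\<Union>(k, y)\<in>K \<times> C. I3 h k y) = (\<Union>k\<in>K. \<Union>y\<in>C. I3 h k y)" for K C
    by blast
  have "Reg h = \<Union> (Reg_fiber h ` realizable_types d \<langle>h, h\<rangle>)"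
    using Union_Reg_orbits[OF h_anisotropic] dim by simp
  also have "\<dots> = (\<Union>k\<in>{1..d}. I1 h k) \<union>
           (\<Union>k\<in>{0..d - 1}. I2 h k) \<union>
           (\<Union>k\<in>{1..d - 1}. \<Union>y\<in>{y. y \<noteq> 0 \<and> y \<noteq> \<langle>h, h\<rangle>}. I3 h k y) \<union>
           (\<Union>k\<in>{1..d - 2}. I4 h k) \<union>
           (\<Union>k\<in>{2..d - 1}. I5 h k)"
    unfolding orbits Union_Un_distrib product ..
  finally show ?thesis using 1 by blast
qed

end
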